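(* Let $P_1,P_2$ be non-commutative Poisson algebras over $K$ of the same class (both of Class 1 or both of Class 2), with degree maps $u_i:P_i\to\mathbb Z_{\ge0}\cup\{-\infty\}$ ($i=1,2$) whose induced filtrations are finite and discrete. Let $z_1\in\Omega_3(P_1)\cup\Omega_3'(P_1)$, $z_2\in P_2$ and $\Gamma=z_1\otimes1+1\otimes z_2\in P_1\otimes P_2$. Then $\Gamma\in\Omega_3(P_1\otimes P_2)\cup\Omega_3'(P_1\otimes P_2)$.
   Context: $K$ is an algebraically closed field of characteristic zero; tensor products are over $K$. A non-commutative Poisson algebra over $K$ is a $K$-vector space $P$ with a bilinear product $\cdot$ making it a unital associative (not necessarily commutative) $K$-algebra and a bilinear bracket $\{\cdot,\cdot\}$ making it a Lie algebra, such that $\{x,yz\}=\{x,y\}z+y\{x,z\}$ for all $x,y,z\in P$. It is of Class 1 if $(P,\cdot)$ is commutative, and of Class 2 if $(P,\cdot)$ is non-commutative and $\{a,b\}=ab-ba$ for all $a,b$. Tensor product: if $P_1,P_2$ are both of Class 1, $P_1\otimes P_2$ carries the bracket $\{a_1\otimes a_2,b_1\otimes b_2\}=\{a_1,b_1\}\otimes a_2b_2+b_1a_1\otimes\{a_2,b_2\}$; if both are of Class 2, the bracket on $P_1\otimes P_2$ is the commutator. This makes $P_1\otimes P_2$ a non-commutative Poisson algebra of the same class. A degree map on $P$ is a map $u:P\to\mathbb Z\cup\{-\infty\}$ such that for all $z,w\in P$: $u(\{z,w\})\le u(zw)=u(z)+u(w)$; $u(z+w)\le\max\{u(z),u(w)\}$;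 $u(z)=-\infty$ iff $z=0$. Its induced filtration is $P_t=\{a\in P\mid u(a)\le t\}$, $t\in\mathbb Z$; it is finite if every $P_t$ is finite dimensional over $K$ and discrete if $P_t=\{0\}$ for all $t<0$. For an element $z$ of a non-commutative Poisson algebra $P$ put $ad_z(w)=\{z,w\}$ and $Ev(z)=\{\lambda\in K\mid \exists x\in P\setminus\{0\},\ ad_z(x)=\lambda x\}$, $F(z)=\{x\in P\mid \dim_K K[ad_z](x)<\infty\}$, $D(z)=\bigoplus_{\lambda\in Ev(z)}\{x\in P\mid ad_z(x)=\lambda x\}$. For $z$ with $Ev(z)\supsetneq\{0\}$: $z\in\Omega_3(P)$ if $D(z)\subsetneq F(z)=P$; $z\in\Omega_3'(P)$ if $D(z)\subsetneq F(z)\subsetneq P$. *)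

theory Defs
  imports
    "HOL-Algebra.Algebraic_Closure"
    "HOL-Algebra.QuotRing"
    "HOL-Library.Extended"
    "Jordan_Normal_Form.Missing_VectorSpace"
begin

section \<open>Non-commutative Poisson algebras\<close>

definition char_zero :: "('k, 'l) ring_scheme \<Rightarrow> bool" where
  "char_zero K \<longleftrightarrow> (\<forall>n::nat. n > 0 \<longrightarrow> [n] \<cdot>\<^bsub>K\<^esub> \<one>\<^bsub>K\<^esub> \<noteq> \<zero>\<^bsub>K\<^esub>)"

record ('k, 'a) nc_poisson = "('k, 'a) module" +
  bracket :: "'a \<Rightarrow> 'a \<Rightarrow> 'a"

text \<open>
  The zero algebra is excluded, following the usual convention \<open>1 \<noteq> 0\<close> for unital algebras.
\<close>

locale nc_poisson_algebra = V?: vectorspace K P + A?: ring P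
  for K :: "('k, 'l) ring_scheme" and P :: "('k, 'a, 'm) nc_poisson_scheme" +
  assumes one_not_zero: "\<one>\<^bsub>P\<^esub> \<noteq> \<zero>\<^bsub>P\<^esub>"
    and smult_mult_left:
      "\<lbrakk>c \<in> carrier K; x \<in> carrier P; y \<in> carrier P\<rbrakk>
        \<Longrightarrow> (c \<odot>\<^bsub>P\<^esub> x) \<otimes>\<^bsub>P\<^esub> y = c \<odot>\<^bsub>P\<^esub> (x \<otimes>\<^bsub>P\<^esub> y)"
    and smult_mult_right:
      "\<lbrakk>c \<in> carrier K; x \<in> carrier P; y \<in> carrier P\<rbrakk>
        \<Longrightarrow> x \<otimes>\<^bsub>P\<^esub> (c \<odot>\<^bsub>P\<^esub> y) = c \<odot>\<^bsub>P\<^esub> (x \<otimes>\<^bsub>P\<^esub> y)"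
    and bracket_closed:
      "\<lbrakk>x \<in> carrier P; y \<in> carrier P\<rbrakk> \<Longrightarrow> bracket P x y \<in> carrier P"
    and bracket_add_left:
      "\<lbrakk>x \<in> carrier P; y \<in> carrier P; z \<in> carrier P\<rbrakk>
        \<Longrightarrow> bracket P (x \<oplus>\<^bsub>P\<^esub> y) z = bracket P x z \<oplus>\<^bsub>P\<^esub> bracket P y z"
    and bracket_add_right:
      "\<lbrakk>x \<in> carrier P; y \<in> carrier P; z \<in> carrier P\<rbrakk>
        \<Longrightarrow> bracket P x (y \<oplus>\<^bsub>P\<^esub> z) = bracket P x y \<oplus>\<^bsub>P\<^esub> bracket P x z"
    and bracket_smult_left:
      "\<lbrakk>c \<in> carrier K; x \<in> carrier P; y \<in> carrier P\<rbrakk>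
        \<Longrightarrow> bracket P (c \<odot>\<^bsub>P\<^esub> x) y = c \<odot>\<^bsub>P\<^esub> bracket P x y"
    and bracket_smult_right:
      "\<lbrakk>c \<in> carrier K; x \<in> carrier P; y \<in> carrier P\<rbrakk>
        \<Longrightarrow> bracket P x (c \<odot>\<^bsub>P\<^esub> y) = c \<odot>\<^bsub>P\<^esub> bracket P x y"
    and bracket_alternating:
      "x \<in> carrier P \<Longrightarrow> bracket P x x = \<zero>\<^bsub>P\<^esub>"
    and jacobi:
      "\<lbrakk>x \<in> carrier P; y \<in> carrier P; z \<in> carrier P\<rbrakk>
        \<Longrightarrow> bracket P x (bracket P y z) \<oplus>\<^bsub>P\<^esub> bracket P y (bracket P z x)
              \<oplus>\<^bsub>P\<^esub> bracket P z (bracket P x y) = \<zero>\<^bsub>P\<^esub>"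
    and leibniz:
      "\<lbrakk>x \<in> carrier P; y \<in> carrier P; z \<in> carrier P\<rbrakk>
        \<Longrightarrow> bracket P x (y \<otimes>\<^bsub>P\<^esub> z) = bracket P x y \<otimes>\<^bsub>P\<^esub> z \<oplus>\<^bsub>P\<^esub> y \<otimes>\<^bsub>P\<^esub> bracket P x z"

definition class1 :: "('k, 'a, 'm) nc_poisson_scheme \<Rightarrow> bool" where
  "class1 P \<longleftrightarrow> (\<forall>a\<in>carrier P. \<forall>b\<in>carrier P. a \<otimes>\<^bsub>P\<^esub> b = b \<otimes>\<^bsub>P\<^esub> a)"

definition class2 :: "('k, 'a, 'm) nc_poisson_scheme \<Rightarrow> bool" where
  "class2 P \<longleftrightarrow>
     (\<exists>a\<in>carrier P. \<exists>b\<in>carrier P. a \<otimes>\<^bsub>P\<^esub> b \<noteq> b \<otimes>\<^bsub>P\<^esub> a) \<and>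
     (\<forall>a\<in>carrier P. \<forall>b\<in>carrier P. bracket P a b = a \<otimes>\<^bsub>P\<^esub> b \<ominus>\<^bsub>P\<^esub> b \<otimes>\<^bsub>P\<^esub> a)"


section \<open>Degree maps and filtrations\<close>

definition degree_map :: "('k, 'a, 'm) nc_poisson_scheme \<Rightarrow> ('a \<Rightarrow> int extended) \<Rightarrow> bool" where
  "degree_map P u \<longleftrightarrow>
     (\<forall>z\<in>carrier P. u z \<noteq> \<infinity>) \<and>
     (\<forall>z\<in>carrier P. \<forall>w\<in>carrier P. u (bracket P z w) \<le> u (z \<otimes>\<^bsub>P\<^esub> w)) \<and>
     (\<forall>z\<in>carrier P. \<forall>w\<in>carrier P. u (z \<otimes>\<^bsub>P\<^esub> w) = u z + u w) \<and>
     (\<forall>z\<in>carrier P. \<forall>w\<in>carrier P. u (z \<oplus>\<^bsub>P\<^esub> w) \<le> max (u z) (u w)) \<and>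
     (\<forall>z\<in>carrier P. u z = -\<infinity> \<longleftrightarrow> z = \<zero>\<^bsub>P\<^esub>)"

definition filtration ::
    "('k, 'a, 'm) nc_poisson_scheme \<Rightarrow> ('a \<Rightarrow> int extended) \<Rightarrow> int \<Rightarrow> 'a set" where
  "filtration P u t = {a \<in> carrier P. u a \<le> Fin t}"

definition finite_dimensional ::
    "('k, 'l) ring_scheme \<Rightarrow> ('k, 'a, 'm) module_scheme \<Rightarrow> 'a set \<Rightarrow> bool" where
  "finite_dimensional K P W \<longleftrightarrow>
     subspace K W P \<and> vectorspace.fin_dim K (P\<lparr>carrier := W\<rparr>)"

definition finite_filtration ::
    "('k, 'l) ring_scheme \<Rightarrow> ('k, 'a, 'm) nc_poisson_scheme \<Rightarrow> ('a \<Rightarrow> int extended) \<Rightarrow> bool" where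
  "finite_filtration K P u \<longleftrightarrow> (\<forall>t. finite_dimensional K P (filtration P u t))"

definition discrete_filtration ::
    "('k, 'a, 'm) nc_poisson_scheme \<Rightarrow> ('a \<Rightarrow> int extended) \<Rightarrow> bool" where
  "discrete_filtration P u \<longleftrightarrow> (\<forall>t<0. filtration P u t = {\<zero>\<^bsub>P\<^esub>})"


section \<open>The adjoint action of an element\<close>

definition eigenspace ::
    "('k, 'a, 'm) nc_poisson_scheme \<Rightarrow> 'a \<Rightarrow> 'k \<Rightarrow> 'a set" where
  "eigenspace P z l = {x \<in> carrier P. bracket P z x = l \<odot>\<^bsub>P\<^esub> x}"

definition Ev :: "('k, 'l) ring_scheme \<Rightarrow> ('k, 'a, 'm) nc_poisson_scheme \<Rightarrow> 'a \<Rightarrow> 'k set" where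
  "Ev K P z = {l \<in> carrier K. \<exists>x\<in>carrier P - {\<zero>\<^bsub>P\<^esub>}. bracket P z x = l \<odot>\<^bsub>P\<^esub> x}"

text \<open>
  \<open>K[ad\<^sub>z](x)\<close>: the elements \<open>p(ad\<^sub>z)(x)\<close>, where \<open>p\<close> is the polynomial with
  coefficients \<open>c 0, \<dots>, c n\<close>.
\<close>

definition ad_orbit ::
    "('k, 'l) ring_scheme \<Rightarrow> ('k, 'a, 'm) nc_poisson_scheme \<Rightarrow> 'a \<Rightarrow> 'a \<Rightarrow> 'a set" where
  "ad_orbit K P z x =
     {\<Oplus>\<^bsub>P\<^esub>i\<in>{..n}. c i \<odot>\<^bsub>P\<^esub> (bracket P z ^^ i) x | n c. c \<in> {..n::nat} \<rightarrow> carrier K}"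

definition Fset :: "('k, 'l) ring_scheme \<Rightarrow> ('k, 'a, 'm) nc_poisson_scheme \<Rightarrow> 'a \<Rightarrow> 'a set" where
  "Fset K P z = {x \<in> carrier P. finite_dimensional K P (ad_orbit K P z x)}"

text \<open>
  The sum of the eigenspaces as a subspace of \<open>P\<close>; it is automatically direct, because
  eigenvectors for distinct eigenvalues are linearly independent.
\<close>

definition Dset :: "('k, 'l) ring_scheme \<Rightarrow> ('k, 'a, 'm) nc_poisson_scheme \<Rightarrow> 'a \<Rightarrow> 'a set" where
  "Dset K P z =
     {\<Oplus>\<^bsub>P\<^esub>l\<in>L. v l | L v. finite L \<and> L \<subseteq> Ev K P z \<and> (\<forall>l\<in>L. v l \<in> eigenspace P z l)}"

definition Omega3 :: "('k, 'l) ring_scheme \<Rightarrow> ('k, 'a, 'm) nc_poisson_scheme \<Rightarrow> 'a set" where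
  "Omega3 K P =
     {z \<in> carrier P. {\<zero>\<^bsub>K\<^esub>} \<subset> Ev K P z \<and> Dset K P z \<subset> Fset K P z \<and> Fset K P z = carrier P}"

definition Omega3' :: "('k, 'l) ring_scheme \<Rightarrow> ('k, 'a, 'm) nc_poisson_scheme \<Rightarrow> 'a set" where
  "Omega3' K P =
     {z \<in> carrier P. {\<zero>\<^bsub>K\<^esub>} \<subset> Ev K P z \<and> Dset K P z \<subset> Fset K P z \<and> Fset K P z \<subset> carrier P}"


section \<open>Tensor products\<close>

text \<open>
  \<open>P\<^sub>1 \<otimes>\<^sub>K P\<^sub>2\<close> is constructed as the quotient of the free \<open>K\<close>-module on
  \<open>P\<^sub>1 \<times> P\<^sub>2\<close> by the bilinearity relations. The free module carries the
  product of the monoid algebra of the direct product of the multiplicative monoids, which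
  induces \<open>(a\<^sub>1 \<otimes> a\<^sub>2)(b\<^sub>1 \<otimes> b\<^sub>2) = a\<^sub>1b\<^sub>1 \<otimes> a\<^sub>2b\<^sub>2\<close> on the quotient.
\<close>

definition single :: "('k, 'l) ring_scheme \<Rightarrow> 'x \<Rightarrow> 'x \<Rightarrow> 'k" where
  "single K p = (\<lambda>q. if q = p then \<one>\<^bsub>K\<^esub> else \<zero>\<^bsub>K\<^esub>)"

definition supp :: "('k, 'l) ring_scheme \<Rightarrow> ('x \<Rightarrow> 'k) \<Rightarrow> 'x set" where
  "supp K f = {p. f p \<noteq> \<zero>\<^bsub>K\<^esub>}"

definition monoid_algebra ::
    "('k, 'l) ring_scheme \<Rightarrow> ('x, 'n) monoid_scheme \<Rightarrow> ('k, 'x \<Rightarrow> 'k) module" where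
  "monoid_algebra K M =
     \<lparr>carrier = {f. (\<forall>p. f p \<in> carrier K) \<and> finite (supp K f) \<and> supp K f \<subseteq> carrier M},
      monoid.mult = (\<lambda>f g m. \<Oplus>\<^bsub>K\<^esub>r\<in>{(p, q) \<in> supp K f \<times> supp K g. p \<otimes>\<^bsub>M\<^esub> q = m}.
                f (fst r) \<otimes>\<^bsub>K\<^esub> g (snd r)),
      one = single K \<one>\<^bsub>M\<^esub>,
      zero = (\<lambda>p. \<zero>\<^bsub>K\<^esub>),
      add = (\<lambda>f g p. f p \<oplus>\<^bsub>K\<^esub> g p),
      smult = (\<lambda>c f p. c \<otimes>\<^bsub>K\<^esub> f p)\<rparr>"

abbreviation pair_algebra ::
    "('k, 'l) ring_scheme \<Rightarrow> ('k, 'a, 'm) nc_poisson_scheme \<Rightarrow> ('k, 'b, 'n) nc_poisson_scheme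
      \<Rightarrow> ('k, 'a \<times> 'b \<Rightarrow> 'k) module" where
  "pair_algebra K P1 P2 \<equiv> monoid_algebra K (P1 \<times>\<times> P2)"

definition tensor_relations ::
    "('k, 'l) ring_scheme \<Rightarrow> ('k, 'a, 'm) nc_poisson_scheme \<Rightarrow> ('k, 'b, 'n) nc_poisson_scheme
      \<Rightarrow> ('a \<times> 'b \<Rightarrow> 'k) set" where
  "tensor_relations K P1 P2 =
     (let F = pair_algebra K P1 P2; e = (\<lambda>a b. single K (a, b)) in
       {e (a \<oplus>\<^bsub>P1\<^esub> a') b \<ominus>\<^bsub>F\<^esub> (e a b \<oplus>\<^bsub>F\<^esub> e a' b) | a a' b.
          a \<in> carrier P1 \<and> a' \<in> carrier P1 \<and> b \<in> carrier P2} \<union>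
       {e a (b \<oplus>\<^bsub>P2\<^esub> b') \<ominus>\<^bsub>F\<^esub> (e a b \<oplus>\<^bsub>F\<^esub> e a b') | a b b'.
          a \<in> carrier P1 \<and> b \<in> carrier P2 \<and> b' \<in> carrier P2} \<union>
       {e (c \<odot>\<^bsub>P1\<^esub> a) b \<ominus>\<^bsub>F\<^esub> c \<odot>\<^bsub>F\<^esub> e a b | c a b.
          c \<in> carrier K \<and> a \<in> carrier P1 \<and> b \<in> carrier P2} \<union>
       {e a (c \<odot>\<^bsub>P2\<^esub> b) \<ominus>\<^bsub>F\<^esub> c \<odot>\<^bsub>F\<^esub> e a b | c a b.
          c \<in> carrier K \<and> a \<in> carrier P1 \<and> b \<in> carrier P2})"

definition tensor_kernel ::
    "('k, 'l) ring_scheme \<Rightarrow> ('k, 'a, 'm) nc_poisson_scheme \<Rightarrow> ('k, 'b, 'n) nc_poisson_scheme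
      \<Rightarrow> ('a \<times> 'b \<Rightarrow> 'k) set" where
  "tensor_kernel K P1 P2 =
     LinearCombinations.module.span K (pair_algebra K P1 P2) (tensor_relations K P1 P2)"

definition tensor_elem ::
    "('k, 'l) ring_scheme \<Rightarrow> ('k, 'a, 'm) nc_poisson_scheme \<Rightarrow> ('k, 'b, 'n) nc_poisson_scheme
      \<Rightarrow> 'a \<Rightarrow> 'b \<Rightarrow> ('a \<times> 'b \<Rightarrow> 'k) set" where
  "tensor_elem K P1 P2 a b =
     tensor_kernel K P1 P2 +>\<^bsub>pair_algebra K P1 P2\<^esub> single K (a, b)"

text \<open>
  The bilinear extension to the free module of the map
  \<open>((a\<^sub>1, a\<^sub>2), (b\<^sub>1, b\<^sub>2)) \<mapsto> {a\<^sub>1, b\<^sub>1} \<otimes> a\<^sub>2b\<^sub>2 + b\<^sub>1a\<^sub>1 \<otimes> {a\<^sub>2, b\<^sub>2}\<close>.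
\<close>

definition pair_bracket ::
    "('k, 'l) ring_scheme \<Rightarrow> ('k, 'a, 'm) nc_poisson_scheme \<Rightarrow> ('k, 'b, 'n) nc_poisson_scheme
      \<Rightarrow> ('a \<times> 'b \<Rightarrow> 'k) \<Rightarrow> ('a \<times> 'b \<Rightarrow> 'k) \<Rightarrow> ('a \<times> 'b \<Rightarrow> 'k)" where
  "pair_bracket K P1 P2 f g =
     (let F = pair_algebra K P1 P2 in
       \<Oplus>\<^bsub>F\<^esub>r\<in>supp K f \<times> supp K g.
         (case r of ((a1, a2), (b1, b2)) \<Rightarrow>
           (f (a1, a2) \<otimes>\<^bsub>K\<^esub> g (b1, b2)) \<odot>\<^bsub>F\<^esub>
             (single K (bracket P1 a1 b1, a2 \<otimes>\<^bsub>P2\<^esub> b2)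
               \<oplus>\<^bsub>F\<^esub> single K (b1 \<otimes>\<^bsub>P1\<^esub> a1, bracket P2 a2 b2))))"

text \<open>
  Operations on cosets are taken representative-wise, as in \<^const>\<open>rcoset_mult\<close>. The
  \<open>else\<close> branch of the bracket is meant for two algebras of Class 2; its value for other pairs
  is irrelevant.
\<close>

definition tensor ::
    "('k, 'l) ring_scheme \<Rightarrow> ('k, 'a, 'm) nc_poisson_scheme \<Rightarrow> ('k, 'b, 'n) nc_poisson_scheme
      \<Rightarrow> ('k, ('a \<times> 'b \<Rightarrow> 'k) set) nc_poisson" where
  "tensor K P1 P2 =
     (let F = pair_algebra K P1 P2; N = tensor_kernel K P1 P2; Q = F Quot N in
       \<lparr>carrier = carrier Q, monoid.mult = monoid.mult Q, one = one Q, zero = zero Q, add = add Q,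
        smult = (\<lambda>c A. \<Union>f\<in>A. N +>\<^bsub>F\<^esub> (c \<odot>\<^bsub>F\<^esub> f)),
        bracket =
          (if class1 P1 \<and> class1 P2
           then (\<lambda>A B. \<Union>f\<in>A. \<Union>g\<in>B. N +>\<^bsub>F\<^esub> pair_bracket K P1 P2 f g)
           else (\<lambda>A B. A \<otimes>\<^bsub>Q\<^esub> B \<ominus>\<^bsub>Q\<^esub> B \<otimes>\<^bsub>Q\<^esub> A))\<rparr>)"

end

theory Submission
  imports Defs
begin

text \<open>
  The map \<open>y \<mapsto> y \<otimes> 1\<close> embeds \<open>P\<^sub>1\<close> into \<open>P\<^sub>1 \<otimes> P\<^sub>2\<close>: a linear functional on \<open>P\<^sub>2\<close> with value
  \<open>1\<close> at \<open>1\<close> provides a retraction. In both classes \<open>{\<Gamma>, y \<otimes> 1} = {z\<^sub>1, y} \<otimes> 1\<close>, so the embedding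
  intertwines \<open>ad\<close> of \<open>z\<^sub>1\<close> with \<open>ad\<close> of \<open>\<Gamma>\<close>; hence it preserves eigenvalues and maps
  \<open>F(z\<^sub>1)\<close> into \<open>F(\<Gamma>)\<close>.

  Let \<open>x \<in> F(z\<^sub>1)\<close> lie outside \<open>D(z\<^sub>1)\<close>. If \<open>x \<otimes> 1\<close> were a sum of eigenvectors of \<open>ad\<close> of \<open>\<Gamma>\<close>
  for distinct eigenvalues, each summand would lie in every invariant subspace containing the sum,
  in particular in \<open>P\<^sub>1 \<otimes> 1\<close>; pulling the summands back to \<open>P\<^sub>1\<close> would give \<open>x \<in> D(z\<^sub>1)\<close>. So
  \<open>x \<otimes> 1\<close> separates \<open>F(\<Gamma>)\<close> from \<open>D(\<Gamma>)\<close>.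
\<close>

text \<open>The operations of \<open>tensor\<close> are unions over all representatives of cosets in
  a very large free module, so its bracket cannot be read off directly. This shapes the second half
  of the development: a map \<open>\<beta>\<close> of two pairs that is linear in every component
  extends to \<open>ext \<beta>\<close> on the free module, and \<open>ext \<beta>\<close> depends
  only on the cosets of its arguments. The bracket of two cosets is then a value of
  \<open>ext tensor_bracket\<close> in Class 1 and a difference of two values of
  \<open>ext tensor_mult\<close> in Class 2.

  The formula for \<open>{\<Gamma>, y \<otimes> 1}\<close> has a different cause in each class. In
  Class 1 every term other than \<open>{z\<^sub>1, y} \<otimes> 1\<close> contains a bracket with
  \<open>1\<close>, which vanishes by the Leibniz rule. In Class 2 the element
  \<open>1 \<otimes> z\<^sub>2\<close> commutes with \<open>y \<otimes> 1\<close>.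

  A summand of a sum of eigenvectors for distinct eigenvalues lies in each invariant subspace
  containing the sum because it is the value at that sum of a polynomial in
  \<open>ad\<close>.\<close>

context abelian_group
begin

lemma add_minus_add_cancel:
  assumes [simp]: "x \<in> carrier G" "y \<in> carrier G" "z \<in> carrier G"
  shows "(x \<oplus> y) \<ominus> (x \<oplus> z) = y \<ominus> z"
proof -
  have "(x \<oplus> y) \<ominus> (x \<oplus> z) = (x \<oplus> \<ominus> x) \<oplus> (y \<oplus> \<ominus> z)"
    unfolding a_minus_def by (simp add: minus_add a_ac del: r_neg)
  then show ?thesis by (simp add: r_neg a_minus_def)
qed

lemma add_neg_cancel_middle:
  "\<lbrakk>x \<in> carrier G; y \<in> carrier G\<rbrakk> \<Longrightarrow> x \<oplus> (y \<oplus> \<ominus> x) = y"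
  by (subst a_comm[of y]) (auto simp: r_neg2)

lemma minus_zero_right: "x \<in> carrier G \<Longrightarrow> x \<ominus> \<zero> = x"
  using add.inv_one by (simp add: a_minus_def)

end

lemma (in abelian_monoid) finsum_cartesian:
  assumes "finite A" "finite B" "\<And>x y. x \<in> A \<Longrightarrow> y \<in> B \<Longrightarrow> f (x, y) \<in> carrier G"
  shows "finsum G f (A \<times> B) = (\<Oplus>x\<in>A. \<Oplus>y\<in>B. f (x, y))"
  using assms(1,3)
proof (induction A rule: finite_induct)
  case empty
  then show ?case by simp
next
  case (insert x A)
  have "finsum G f (insert x A \<times> B) = finsum G f ({x} \<times> B \<union> A \<times> B)"
    by (rule arg_cong[where f = "finsum G f"]) auto
  also have "\<dots> = finsum G f ({x} \<times> B) \<oplus> finsum G f (A \<times> B)"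
    using insert.hyps assms(2) insert.prems by (intro finsum_Un_disjoint) auto
  also have "finsum G f ({x} \<times> B) = finsum G f (Pair x ` B)"
    by (rule arg_cong[where f = "finsum G f"]) auto
  also have "\<dots> = (\<Oplus>y\<in>B. f (x, y))"
    using insert.prems by (intro finsum_reindex) (auto simp: inj_on_def)
  finally show ?case
    using insert by (simp add: finsum_insert Pi_def)
qed

section \<open>Subspaces, finite dimension and linear functionals\<close>

lemma (in vectorspace) finsum_mem_subspace:
  assumes "subspace K W V" and "f \<in> A \<rightarrow> W"
  shows "finsum V f A \<in> W"
proof -
  interpret W: LinearCombinations.submodule K W V
    using assms(1) by (rule is_module)
  show ?thesis
    using assms(2)
  proof (induction A rule: infinite_finite_induct)
    case (insert x A)
    have "f \<in> A \<rightarrow> carrier V" "f x \<in> carrier V"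
      using insert.prems W.subset by auto
    then show ?case
      using insert by (subst finsum_insert) auto
  qed auto
qed

text \<open>The definition speaks of the space with restricted carrier. Spans in it agree with spans
  in the ambient space, so a finite spanning set can be named inside \<open>V\<close>, a form that
  transports along linear maps.\<close>

lemma (in vectorspace) finite_dimensional_iff:
  "finite_dimensional K V W \<longleftrightarrow> (\<exists>B. finite B \<and> B \<subseteq> carrier V \<and> W = span B)"
proof
  assume W: "finite_dimensional K V W"
  then have sub: "subspace K W V"
    by (simp add: finite_dimensional_def)
  interpret S: LinearCombinations.submodule K W V
    using sub by (rule is_module)
  interpret W: vectorspace K "vs W"
    using sub by (rule subspace_is_vs)
  have "W.fin_dim" using W by (simp add: finite_dimensional_def)
  then obtain B where B: "finite B" "B \<subseteq> W" "W.span B = W"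
    unfolding W.fin_dim_def by auto
  then have "span B = W"
    using span_li_not_depend(1)[OF B(2)] sub by simp
  then show "\<exists>B. finite B \<and> B \<subseteq> carrier V \<and> W = span B"
    using B S.subset by blast
next
  assume "\<exists>B. finite B \<and> B \<subseteq> carrier V \<and> W = span B"
  then obtain B where B: "finite B" "B \<subseteq> carrier V" "W = span B"
    by blast
  have sub: "subspace K W V"
    using B span_is_subspace by simp
  interpret W: vectorspace K "vs W"
    using sub by (rule subspace_is_vs)
  have BW: "B \<subseteq> W"
    using B in_own_span by simp
  have "W.fin_dim"
    unfolding W.fin_dim_def
    using B BW span_li_not_depend(1)[OF BW] sub by auto
  then show "finite_dimensional K V W"
    using sub by (simp add: finite_dimensional_def)
qed

lemma (in mod_hom) hom_finsum:
  "g \<in> A \<rightarrow> carrier M \<Longrightarrow> f (finsum M g A) = finsum N (\<lambda>a. f (g a)) A"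
proof (induction A rule: infinite_finite_induct)
  case (insert x A)
  then have "f (finsum M g (insert x A)) = f (g x) \<oplus>\<^bsub>N\<^esub> finsum N (\<lambda>a. f (g a)) A"
    by (subst M.M.finsum_insert) (auto simp: Pi_def)
  also have "\<dots> = finsum N (\<lambda>a. f (g a)) (insert x A)"
    using insert by (subst N.M.finsum_insert) (auto simp: Pi_def)
  finally show ?case .
qed auto

text \<open>
  A subspace maximal among those avoiding \<open>e\<close> is a complement of the line through \<open>e\<close>, and the
  functional is the coordinate along \<open>e\<close>.
\<close>

lemma (in vectorspace) functional_one_exists:
  assumes e: "e \<in> carrier V" "e \<noteq> \<zero>\<^bsub>V\<^esub>"
  shows "\<exists>\<phi>. (\<forall>x\<in>carrier V. \<phi> x \<in> carrier K)
    \<and> (\<forall>x\<in>carrier V. \<forall>y\<in>carrier V. \<phi> (x \<oplus>\<^bsub>V\<^esub> y) = \<phi> x \<oplus>\<^bsub>K\<^esub> \<phi> y)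
    \<and> (\<forall>c\<in>carrier K. \<forall>x\<in>carrier V. \<phi> (c \<odot>\<^bsub>V\<^esub> x) = c \<otimes>\<^bsub>K\<^esub> \<phi> x)
    \<and> \<phi> e = \<one>\<^bsub>K\<^esub>"
proof -
  define A where "A = {W. LinearCombinations.submodule K W V \<and> e \<notin> W}"
  have "{\<zero>\<^bsub>V\<^esub>} \<in> A"
    using e module_axioms by (auto simp: A_def intro!: submodule.intro)
  moreover have "\<Union>C \<in> A" if C: "C \<noteq> {}" "subset.chain A C" for C
  proof -
    have "LinearCombinations.submodule K (\<Union>C) V"
    proof (rule nested_union_vs[where I = C and N = "\<lambda>W. W"])
      show "\<exists>k. k \<in> C \<and> i \<subseteq> k \<and> j \<subseteq> k" if "i \<in> C" "j \<in> C" for i j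
      proof -
        have "i \<subseteq> j \<or> j \<subseteq> i"
          using C(2) that by (auto simp: subset_chain_def)
        then show ?thesis using that by blast
      qed
    qed (use C in \<open>auto simp: subset_chain_def A_def\<close>)
    then show ?thesis
      using C(2) by (auto simp: A_def subset_chain_def)
  qed
  ultimately obtain W where W: "W \<in> A" and max: "\<And>U. U \<in> A \<Longrightarrow> W \<subseteq> U \<Longrightarrow> U = W"
    using subset_Zorn_nonempty[of A] by blast
  interpret W: LinearCombinations.submodule K W V
    using W by (simp add: A_def)
  have eW: "e \<notin> W"
    using W by (simp add: A_def)
  have W_minus: "\<ominus>\<^bsub>V\<^esub> x \<in> W" if "x \<in> W" for x
  proof -
    have "(\<ominus>\<^bsub>K\<^esub> \<one>\<^bsub>K\<^esub>) \<odot>\<^bsub>V\<^esub> x \<in> W"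
      using that by (intro W.smult_closed) auto
    then show ?thesis
      using that W.subset by (subst (asm) smult_minus_1) auto
  qed
  \<comment> \<open>For \<open>x\<close> outside \<open>W\<close>, maximality forces
    \<open>e\<close> into \<open>W + K x\<close>, say \<open>e = w + c x\<close>. Here
    \<open>c\<close> is nonzero because \<open>e\<close> is not in \<open>W\<close>, and the
    required coefficient is the inverse of \<open>c\<close>.\<close>
  have decomp: "\<exists>c\<in>carrier K. x \<ominus>\<^bsub>V\<^esub> c \<odot>\<^bsub>V\<^esub> e \<in> W" if x: "x \<in> carrier V" for x
  proof (cases "x \<in> W")
    case True
    then show ?thesis
      using x e by (intro bexI[of _ "\<zero>\<^bsub>K\<^esub>"]) (auto simp: M.minus_zero_right)
  next
    case False
    define U where "U = {w \<oplus>\<^bsub>V\<^esub> c \<odot>\<^bsub>V\<^esub> x | w c. w \<in> W \<and> c \<in> carrier K}"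
    have UI: "w \<oplus>\<^bsub>V\<^esub> c \<odot>\<^bsub>V\<^esub> x \<in> U" if "w \<in> W" "c \<in> carrier K" for w c
      using that by (auto simp: U_def)
    have "LinearCombinations.submodule K U V"
    proof
      show "U \<subseteq> carrier V" using W.subset x by (auto simp: U_def)
      show "\<zero>\<^bsub>V\<^esub> \<in> U"
        using UI[of "\<zero>\<^bsub>V\<^esub>" "\<zero>\<^bsub>K\<^esub>"] x by simp
      fix v v' assume "v \<in> U" "v' \<in> U"
      then obtain w c w' c' where v: "v = w \<oplus>\<^bsub>V\<^esub> c \<odot>\<^bsub>V\<^esub> x" "v' = w' \<oplus>\<^bsub>V\<^esub> c' \<odot>\<^bsub>V\<^esub> x"
        and wc: "w \<in> W" "w' \<in> W" "c \<in> carrier K" "c' \<in> carrier K"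
        by (auto simp: U_def)
      have wV: "w \<in> carrier V" "w' \<in> carrier V" using wc W.subset by auto
      have "v \<oplus>\<^bsub>V\<^esub> v' = (w \<oplus>\<^bsub>V\<^esub> w') \<oplus>\<^bsub>V\<^esub> (c \<oplus>\<^bsub>K\<^esub> c') \<odot>\<^bsub>V\<^esub> x"
        using wc wV x by (simp add: v smult_l_distr M.a_ac)
      then show "v \<oplus>\<^bsub>V\<^esub> v' \<in> U" using UI wc by simp
    next
      fix a v assume "a \<in> carrier K" "v \<in> U"
      then obtain w c where v: "v = w \<oplus>\<^bsub>V\<^esub> c \<odot>\<^bsub>V\<^esub> x" and wc: "w \<in> W" "c \<in> carrier K"
        by (auto simp: U_def)
      have "w \<in> carrier V" using wc W.subset by auto
      then have "a \<odot>\<^bsub>V\<^esub> v = a \<odot>\<^bsub>V\<^esub> w \<oplus>\<^bsub>V\<^esub> (a \<otimes>\<^bsub>K\<^esub> c) \<odot>\<^bsub>V\<^esub> x"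
        using wc x \<open>a \<in> carrier K\<close> by (simp add: v smult_r_distr smult_assoc1)
      then show "a \<odot>\<^bsub>V\<^esub> v \<in> U" using UI wc \<open>a \<in> carrier K\<close> by simp
    qed
    moreover have "W \<subseteq> U"
    proof
      fix w assume "w \<in> W"
      then show "w \<in> U"
        using UI[of w "\<zero>\<^bsub>K\<^esub>"] x W.subset by auto
    qed
    moreover have "x \<in> U"
      using UI[of "\<zero>\<^bsub>V\<^esub>" "\<one>\<^bsub>K\<^esub>"] x by simp
    ultimately have "e \<in> U"
      using max[of U] False by (auto simp: A_def)
    then obtain w c where ewc: "e = w \<oplus>\<^bsub>V\<^esub> c \<odot>\<^bsub>V\<^esub> x" and wc: "w \<in> W" "c \<in> carrier K"
      by (auto simp: U_def)
    have w: "w \<in> carrier V" using wc W.subset by auto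
    have "c \<noteq> \<zero>\<^bsub>K\<^esub>"
      using ewc eW wc w x by auto
    then have d: "inv\<^bsub>K\<^esub> c \<in> carrier K" "inv\<^bsub>K\<^esub> c \<otimes>\<^bsub>K\<^esub> c = \<one>\<^bsub>K\<^esub>"
      using wc by (auto simp: field_Units)
    have "inv\<^bsub>K\<^esub> c \<odot>\<^bsub>V\<^esub> e = inv\<^bsub>K\<^esub> c \<odot>\<^bsub>V\<^esub> w \<oplus>\<^bsub>V\<^esub> x"
      using d w wc x unfolding ewc by (simp add: smult_r_distr smult_assoc1[symmetric])
    then have "x \<ominus>\<^bsub>V\<^esub> inv\<^bsub>K\<^esub> c \<odot>\<^bsub>V\<^esub> e = \<ominus>\<^bsub>V\<^esub> (inv\<^bsub>K\<^esub> c \<odot>\<^bsub>V\<^esub> w)"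
      using d w x by (simp add: a_minus_def M.minus_add M.add_neg_cancel_middle)
    then have "x \<ominus>\<^bsub>V\<^esub> inv\<^bsub>K\<^esub> c \<odot>\<^bsub>V\<^esub> e \<in> W"
      using W_minus[OF W.smult_closed[OF d(1) wc(1)]] by simp
    then show ?thesis
      using d(1) by blast
  qed
  \<comment> \<open>Two different coefficients would put a nonzero multiple of \<open>e\<close>,
    hence \<open>e\<close> itself, into \<open>W\<close>. Uniqueness is what makes the coordinate
    function linear.\<close>
  have unique: "c = d" if "c \<in> carrier K" "d \<in> carrier K" "x \<in> carrier V"
    "x \<ominus>\<^bsub>V\<^esub> c \<odot>\<^bsub>V\<^esub> e \<in> W" "x \<ominus>\<^bsub>V\<^esub> d \<odot>\<^bsub>V\<^esub> e \<in> W" for c d x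
  proof (rule ccontr)
    assume "c \<noteq> d"
    then have cd: "c \<ominus>\<^bsub>K\<^esub> d \<in> carrier K" "c \<ominus>\<^bsub>K\<^esub> d \<noteq> \<zero>\<^bsub>K\<^esub>"
      using that by auto
    have "(x \<ominus>\<^bsub>V\<^esub> d \<odot>\<^bsub>V\<^esub> e) \<oplus>\<^bsub>V\<^esub> \<ominus>\<^bsub>V\<^esub> (x \<ominus>\<^bsub>V\<^esub> c \<odot>\<^bsub>V\<^esub> e) \<in> W"
      using that W_minus by auto
    also have "(x \<ominus>\<^bsub>V\<^esub> d \<odot>\<^bsub>V\<^esub> e) \<oplus>\<^bsub>V\<^esub> \<ominus>\<^bsub>V\<^esub> (x \<ominus>\<^bsub>V\<^esub> c \<odot>\<^bsub>V\<^esub> e) = (c \<ominus>\<^bsub>K\<^esub> d) \<odot>\<^bsub>V\<^esub> e"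
      using that e
      by (simp add: a_minus_def M.minus_add smult_l_distr smult_l_minus M.a_ac
          M.add_neg_cancel_middle M.r_neg2)
    finally have "inv\<^bsub>K\<^esub> (c \<ominus>\<^bsub>K\<^esub> d) \<odot>\<^bsub>V\<^esub> ((c \<ominus>\<^bsub>K\<^esub> d) \<odot>\<^bsub>V\<^esub> e) \<in> W"
      using cd by simp
    then show False
      using cd e eW by (simp add: smult_assoc1[symmetric] field_Units del: minus_other_side)
  qed
  have "\<forall>x\<in>carrier V. \<exists>c. c \<in> carrier K \<and> x \<ominus>\<^bsub>V\<^esub> c \<odot>\<^bsub>V\<^esub> e \<in> W"
    using decomp by blast
  from bchoice[OF this] obtain \<phi> where
    \<phi>: "\<And>x. x \<in> carrier V \<Longrightarrow> \<phi> x \<in> carrier K \<and> x \<ominus>\<^bsub>V\<^esub> \<phi> x \<odot>\<^bsub>V\<^esub> e \<in> W"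
    by blast
  have \<phi>_eq: "\<phi> x = c" if "x \<in> carrier V" "c \<in> carrier K" "x \<ominus>\<^bsub>V\<^esub> c \<odot>\<^bsub>V\<^esub> e \<in> W" for x c
    using \<phi>[OF that(1)] that by (intro unique[of _ _ x]) auto
  show ?thesis
  proof (intro exI[of _ \<phi>] conjI ballI)
    show "\<phi> x \<in> carrier K" if "x \<in> carrier V" for x
      using \<phi> that by blast
    show "\<phi> (x \<oplus>\<^bsub>V\<^esub> y) = \<phi> x \<oplus>\<^bsub>K\<^esub> \<phi> y" if xy: "x \<in> carrier V" "y \<in> carrier V" for x y
    proof (rule \<phi>_eq)
      have p: "\<phi> x \<in> carrier K" "\<phi> y \<in> carrier K"
        using \<phi> xy by auto
      have "(x \<oplus>\<^bsub>V\<^esub> y) \<ominus>\<^bsub>V\<^esub> (\<phi> x \<oplus>\<^bsub>K\<^esub> \<phi> y) \<odot>\<^bsub>V\<^esub> e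
        = (x \<ominus>\<^bsub>V\<^esub> \<phi> x \<odot>\<^bsub>V\<^esub> e) \<oplus>\<^bsub>V\<^esub> (y \<ominus>\<^bsub>V\<^esub> \<phi> y \<odot>\<^bsub>V\<^esub> e)"
        using xy p e by (simp add: a_minus_def smult_l_distr M.minus_add M.a_ac)
      then show "(x \<oplus>\<^bsub>V\<^esub> y) \<ominus>\<^bsub>V\<^esub> (\<phi> x \<oplus>\<^bsub>K\<^esub> \<phi> y) \<odot>\<^bsub>V\<^esub> e \<in> W"
        using \<phi> xy by simp
    qed (use xy \<phi> in auto)
    show "\<phi> (c \<odot>\<^bsub>V\<^esub> x) = c \<otimes>\<^bsub>K\<^esub> \<phi> x" if cx: "c \<in> carrier K" "x \<in> carrier V" for c x
    proof (rule \<phi>_eq)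
      have p: "\<phi> x \<in> carrier K"
        using \<phi> cx by auto
      have "c \<odot>\<^bsub>V\<^esub> x \<ominus>\<^bsub>V\<^esub> (c \<otimes>\<^bsub>K\<^esub> \<phi> x) \<odot>\<^bsub>V\<^esub> e = c \<odot>\<^bsub>V\<^esub> (x \<ominus>\<^bsub>V\<^esub> \<phi> x \<odot>\<^bsub>V\<^esub> e)"
        using cx p e by (simp add: a_minus_def smult_r_distr smult_r_minus smult_assoc1)
      then show "c \<odot>\<^bsub>V\<^esub> x \<ominus>\<^bsub>V\<^esub> (c \<otimes>\<^bsub>K\<^esub> \<phi> x) \<odot>\<^bsub>V\<^esub> e \<in> W"
        using \<phi> cx by simp
    qed (use cx \<phi> in auto)
    show "\<phi> e = \<one>\<^bsub>K\<^esub>"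
      using e by (intro \<phi>_eq) (auto simp: a_minus_def M.r_neg)
  qed
qed

section \<open>Orbits and eigenvectors of an adjoint action\<close>

text \<open>Only the single map \<open>bracket P z\<close> is constrained. The locale thus covers
  \<open>P1\<close> with \<open>z1\<close> as well as the tensor product with \<Gamma>, where
  linearity comes from an explicit formula on cosets.\<close>

locale ad_linear = vectorspace K P
  for K :: "('k, 'l) ring_scheme" and P :: "('k, 'a, 'm) nc_poisson_scheme" +
  fixes z :: 'a
  assumes ad_closed: "x \<in> carrier P \<Longrightarrow> bracket P z x \<in> carrier P"
    and ad_add: "\<lbrakk>x \<in> carrier P; y \<in> carrier P\<rbrakk>
      \<Longrightarrow> bracket P z (x \<oplus>\<^bsub>P\<^esub> y) = bracket P z x \<oplus>\<^bsub>P\<^esub> bracket P z y"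
    and ad_smult: "\<lbrakk>c \<in> carrier K; x \<in> carrier P\<rbrakk>
      \<Longrightarrow> bracket P z (c \<odot>\<^bsub>P\<^esub> x) = c \<odot>\<^bsub>P\<^esub> bracket P z x"
begin

sublocale ad: mod_hom K P P "bracket P z"
  by unfold_locales (auto simp: module_hom_def ad_closed ad_add ad_smult)

definition invariant :: "'a set \<Rightarrow> bool" where
  "invariant W \<longleftrightarrow> subspace K W P \<and> (\<forall>w\<in>W. bracket P z w \<in> W)"

lemma invariantI:
  assumes "W \<subseteq> carrier P" "\<zero>\<^bsub>P\<^esub> \<in> W" "\<And>x y. x \<in> W \<Longrightarrow> y \<in> W \<Longrightarrow> x \<oplus>\<^bsub>P\<^esub> y \<in> W"
    "\<And>c x. c \<in> carrier K \<Longrightarrow> x \<in> W \<Longrightarrow> c \<odot>\<^bsub>P\<^esub> x \<in> W" "\<And>x. x \<in> W \<Longrightarrow> bracket P z x \<in> W"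
  shows "invariant W"
  unfolding invariant_def
  using assms vectorspace_axioms module_axioms
  by (auto intro!: subspace.intro submodule.intro)

lemma invariantD:
  assumes "invariant W"
  shows "W \<subseteq> carrier P" "\<zero>\<^bsub>P\<^esub> \<in> W" "\<And>x y. x \<in> W \<Longrightarrow> y \<in> W \<Longrightarrow> x \<oplus>\<^bsub>P\<^esub> y \<in> W"
    "\<And>c x. c \<in> carrier K \<Longrightarrow> x \<in> W \<Longrightarrow> c \<odot>\<^bsub>P\<^esub> x \<in> W" "\<And>x. x \<in> W \<Longrightarrow> bracket P z x \<in> W"
    "\<And>f A. f \<in> A \<rightarrow> W \<Longrightarrow> finsum P f A \<in> W"
proof -
  interpret W: LinearCombinations.submodule K W P
    using assms by (auto simp: invariant_def intro: is_module)
  show "W \<subseteq> carrier P" "\<zero>\<^bsub>P\<^esub> \<in> W" "\<And>x y. x \<in> W \<Longrightarrow> y \<in> W \<Longrightarrow> x \<oplus>\<^bsub>P\<^esub> y \<in> W"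
    "\<And>c x. c \<in> carrier K \<Longrightarrow> x \<in> W \<Longrightarrow> c \<odot>\<^bsub>P\<^esub> x \<in> W" "\<And>x. x \<in> W \<Longrightarrow> bracket P z x \<in> W"
    using W.subset assms by (auto simp: invariant_def)
  show "\<And>f A. f \<in> A \<rightarrow> W \<Longrightarrow> finsum P f A \<in> W"
    using assms finsum_mem_subspace by (auto simp: invariant_def)
qed

lemma invariant_minus:
  assumes "invariant W" "x \<in> W" "y \<in> W"
  shows "x \<ominus>\<^bsub>P\<^esub> y \<in> W"
proof -
  have "y \<in> carrier P" using assms invariantD(1) by blast
  then have "\<ominus>\<^bsub>P\<^esub> y \<in> W"
    using invariantD(4)[OF assms(1), of "\<ominus>\<^bsub>K\<^esub> \<one>\<^bsub>K\<^esub>" y] assms smult_minus_1[of y] by simp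
  then show ?thesis
    using assms invariantD(3) by (simp add: a_minus_def)
qed

lemma ad_iterate_closed: "x \<in> carrier P \<Longrightarrow> (bracket P z ^^ i) x \<in> carrier P"
  by (induction i) (auto simp: ad_closed)

text \<open>Padding the coefficients with zeros frees a representation from its particular length,
  so that two elements of the orbit can be written with the same number of terms and added
  termwise.\<close>

lemma ad_orbit_eventually:
  assumes "y \<in> ad_orbit K P z x" "x \<in> carrier P"
  shows "\<exists>n c. (\<forall>i. c i \<in> carrier K)
    \<and> (\<forall>m\<ge>n. y = (\<Oplus>\<^bsub>P\<^esub>i\<in>{..m}. c i \<odot>\<^bsub>P\<^esub> (bracket P z ^^ i) x))"
proof -
  obtain n c where c: "c \<in> {..n::nat} \<rightarrow> carrier K"
    and y: "y = (\<Oplus>\<^bsub>P\<^esub>i\<in>{..n}. c i \<odot>\<^bsub>P\<^esub> (bracket P z ^^ i) x)"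
    using assms(1) by (auto simp: ad_orbit_def)
  define d where "d i = (if i \<le> n then c i else \<zero>\<^bsub>K\<^esub>)" for i
  have d: "d i \<in> carrier K" for i
    using c by (auto simp: d_def)
  have "y = (\<Oplus>\<^bsub>P\<^esub>i\<in>{..m}. d i \<odot>\<^bsub>P\<^esub> (bracket P z ^^ i) x)" if "n \<le> m" for m
    unfolding y using that c assms(2)
    by (intro add.finprod_mono_neutral_cong_left) (auto simp: d_def ad_iterate_closed Pi_def)
  with d show ?thesis by blast
qed

lemma ad_orbitI:
  assumes "\<And>i. c i \<in> carrier K"
  shows "(\<Oplus>\<^bsub>P\<^esub>i\<in>{..n}. c i \<odot>\<^bsub>P\<^esub> (bracket P z ^^ i) x) \<in> ad_orbit K P z x"
  using assms by (auto simp: ad_orbit_def)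

lemma invariant_ad_orbit:
  assumes x: "x \<in> carrier P"
  shows "invariant (ad_orbit K P z x)"
proof (rule invariantI)
  show "ad_orbit K P z x \<subseteq> carrier P"
    using x by (auto simp: ad_orbit_def ad_iterate_closed Pi_def intro!: finsum_closed)
  show "\<zero>\<^bsub>P\<^esub> \<in> ad_orbit K P z x"
    using ad_orbitI[where c = "\<lambda>_. \<zero>\<^bsub>K\<^esub>" and n = 0 and x = x] x by simp
next
  fix y y' assume yy': "y \<in> ad_orbit K P z x" "y' \<in> ad_orbit K P z x"
  obtain n c where c: "\<And>i. c i \<in> carrier K"
    and y: "\<And>m. n \<le> m \<Longrightarrow> y = (\<Oplus>\<^bsub>P\<^esub>i\<in>{..m}. c i \<odot>\<^bsub>P\<^esub> (bracket P z ^^ i) x)"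
    using ad_orbit_eventually[OF yy'(1) x] by blast
  obtain n' c' where c': "\<And>i. c' i \<in> carrier K"
    and y': "\<And>m. n' \<le> m \<Longrightarrow> y' = (\<Oplus>\<^bsub>P\<^esub>i\<in>{..m}. c' i \<odot>\<^bsub>P\<^esub> (bracket P z ^^ i) x)"
    using ad_orbit_eventually[OF yy'(2) x] by blast
  have "y \<oplus>\<^bsub>P\<^esub> y' = (\<Oplus>\<^bsub>P\<^esub>i\<in>{..max n n'}. (c i \<oplus>\<^bsub>K\<^esub> c' i) \<odot>\<^bsub>P\<^esub> (bracket P z ^^ i) x)"
    using c c' x unfolding y[OF max.cobounded1[of n n']] y'[OF max.cobounded2[of n' n]]
    by (simp add: smult_l_distr ad_iterate_closed finsum_addf Pi_def)
  then show "y \<oplus>\<^bsub>P\<^esub> y' \<in> ad_orbit K P z x"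
    using c c' by (auto intro: ad_orbitI)
next
  fix a y assume a: "a \<in> carrier K" and yO: "y \<in> ad_orbit K P z x"
  obtain n c where c: "\<And>i. c i \<in> carrier K"
    and y: "\<And>m. n \<le> m \<Longrightarrow> y = (\<Oplus>\<^bsub>P\<^esub>i\<in>{..m}. c i \<odot>\<^bsub>P\<^esub> (bracket P z ^^ i) x)"
    using ad_orbit_eventually[OF yO x] by blast
  have "a \<odot>\<^bsub>P\<^esub> y = (\<Oplus>\<^bsub>P\<^esub>i\<in>{..n}. (a \<otimes>\<^bsub>K\<^esub> c i) \<odot>\<^bsub>P\<^esub> (bracket P z ^^ i) x)"
    using a c x unfolding y[OF order_refl] by (simp add: smult_assoc1 finsum_smult ad_iterate_closed Pi_def)
  then show "a \<odot>\<^bsub>P\<^esub> y \<in> ad_orbit K P z x"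
    using a c by (auto intro: ad_orbitI)
next
  fix y assume yO: "y \<in> ad_orbit K P z x"
  obtain n c where c: "\<And>i. c i \<in> carrier K"
    and y: "\<And>m. n \<le> m \<Longrightarrow> y = (\<Oplus>\<^bsub>P\<^esub>i\<in>{..m}. c i \<odot>\<^bsub>P\<^esub> (bracket P z ^^ i) x)"
    using ad_orbit_eventually[OF yO x] by blast
  \<comment> \<open>Applying \<open>ad\<close> multiplies the polynomial by its variable: the
    coefficients move up by one place and the constant one becomes zero.\<close>
  define d where "d i = (case i of 0 \<Rightarrow> \<zero>\<^bsub>K\<^esub> | Suc j \<Rightarrow> c j)" for i
  have d: "d i \<in> carrier K" for i
    using c by (auto simp: d_def split: nat.split)
  have "bracket P z y = (\<Oplus>\<^bsub>P\<^esub>i\<in>{..n}. c i \<odot>\<^bsub>P\<^esub> (bracket P z ^^ Suc i) x)"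
    using c x unfolding y[OF order_refl] by (simp add: ad.hom_finsum ad_iterate_closed Pi_def ad_smult)
  also have "\<dots> = (\<Oplus>\<^bsub>P\<^esub>i\<in>{..Suc n}. d i \<odot>\<^bsub>P\<^esub> (bracket P z ^^ i) x)"
    using c d x
    by (subst finsum_Suc2)
      (auto simp: d_def ad_iterate_closed ad_closed intro!: finsum_closed M.r_zero[symmetric])
  finally show "bracket P z y \<in> ad_orbit K P z x"
    using d ad_orbitI by metis
qed

lemma mem_ad_orbit: "x \<in> carrier P \<Longrightarrow> x \<in> ad_orbit K P z x"
  using ad_orbitI[where c = "\<lambda>_. \<one>\<^bsub>K\<^esub>" and n = 0 and x = x] by simp

text \<open>With \<open>invariant_ad_orbit\<close> and \<open>mem_ad_orbit\<close> this makes the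
  orbit the smallest invariant subspace containing \<open>x\<close>. Orbits are compared below
  through this property, without touching coefficients.\<close>

lemma ad_orbit_subset:
  assumes W: "invariant W" and x: "x \<in> W"
  shows "ad_orbit K P z x \<subseteq> W"
proof -
  have "(bracket P z ^^ i) x \<in> W" for i
    using W x by (induction i) (auto simp: invariantD(5))
  then show ?thesis
    using W by (auto simp: ad_orbit_def Pi_def intro!: invariantD(4,6)[OF W])
qed

text \<open>
  Applying \<open>ad - m\<close> kills the summand for the eigenvalue \<open>m\<close> and scales the others by nonzero
  factors, which drives the induction.
\<close>

lemma eigenvector_mem_invariant:
  assumes "finite L" "L \<subseteq> carrier K" "\<forall>l\<in>L. v l \<in> eigenspace P z l"
    and W: "invariant W" and "finsum P v L \<in> W"
  shows "\<forall>l\<in>L. v l \<in> W"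
  using assms(1-3,5)
proof (induction L arbitrary: v rule: finite_induct)
  case empty
  then show ?case by simp
next
  case (insert m L)
  have vc: "v l \<in> carrier P" and ad_v: "bracket P z (v l) = l \<odot>\<^bsub>P\<^esub> v l" if "l \<in> insert m L" for l
    using insert.prems(2) that by (auto simp: eigenspace_def)
  have K: "m \<in> carrier K" "\<And>l. l \<in> L \<Longrightarrow> l \<in> carrier K"
    using insert.prems(1) by auto
  define s where "s = finsum P v L"
  have s: "s \<in> carrier P"
    using vc by (auto simp: s_def)
  have total: "finsum P v (insert m L) = v m \<oplus>\<^bsub>P\<^esub> s"
    unfolding s_def using vc insert.hyps by (subst finsum_insert) auto
  define t where "t = bracket P z (v m \<oplus>\<^bsub>P\<^esub> s) \<ominus>\<^bsub>P\<^esub> m \<odot>\<^bsub>P\<^esub> (v m \<oplus>\<^bsub>P\<^esub> s)"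
  have tW: "t \<in> W"
    using insert.prems(3) K W unfolding t_def total
    by (auto intro!: invariant_minus invariantD(4,5)[OF W])
  have ad_s: "bracket P z s = (\<Oplus>\<^bsub>P\<^esub>l\<in>L. l \<odot>\<^bsub>P\<^esub> v l)"
  proof -
    have "bracket P z s = (\<Oplus>\<^bsub>P\<^esub>l\<in>L. bracket P z (v l))"
      unfolding s_def using vc by (auto intro: ad.hom_finsum)
    also have "\<dots> = (\<Oplus>\<^bsub>P\<^esub>l\<in>L. l \<odot>\<^bsub>P\<^esub> v l)"
      using vc ad_v K by (intro finsum_cong') auto
    finally show ?thesis .
  qed
  \<comment> \<open>The sign is moved into the scalar so that this sum and the one for
    \<open>bracket P z s\<close> merge term by term.\<close>
  have m_s: "\<ominus>\<^bsub>P\<^esub> (m \<odot>\<^bsub>P\<^esub> s) = (\<Oplus>\<^bsub>P\<^esub>l\<in>L. (\<ominus>\<^bsub>K\<^esub> m) \<odot>\<^bsub>P\<^esub> v l)"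
    unfolding smult_l_minus[OF K(1) s, symmetric] unfolding s_def
    using K vc by (intro finsum_smult) auto
  have "t = bracket P z s \<ominus>\<^bsub>P\<^esub> m \<odot>\<^bsub>P\<^esub> s"
  proof -
    have c: "m \<odot>\<^bsub>P\<^esub> v m \<in> carrier P" "bracket P z s \<in> carrier P" "m \<odot>\<^bsub>P\<^esub> s \<in> carrier P"
      using K s vc ad_closed by auto
    have "t = (m \<odot>\<^bsub>P\<^esub> v m \<oplus>\<^bsub>P\<^esub> bracket P z s) \<ominus>\<^bsub>P\<^esub> (m \<odot>\<^bsub>P\<^esub> v m \<oplus>\<^bsub>P\<^esub> m \<odot>\<^bsub>P\<^esub> s)"
      unfolding t_def using s vc K ad_v by (simp add: ad_add smult_r_distr)
    also have "\<dots> = bracket P z s \<ominus>\<^bsub>P\<^esub> m \<odot>\<^bsub>P\<^esub> s"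
      using c by (intro M.add_minus_add_cancel)
    finally show ?thesis .
  qed
  also have "\<dots> = (\<Oplus>\<^bsub>P\<^esub>l\<in>L. l \<odot>\<^bsub>P\<^esub> v l \<oplus>\<^bsub>P\<^esub> (\<ominus>\<^bsub>K\<^esub> m) \<odot>\<^bsub>P\<^esub> v l)"
    using K vc unfolding ad_s m_s a_minus_def by (subst finsum_addf) auto
  also have "\<dots> = (\<Oplus>\<^bsub>P\<^esub>l\<in>L. (l \<ominus>\<^bsub>K\<^esub> m) \<odot>\<^bsub>P\<^esub> v l)"
    using K vc by (intro finsum_cong') (auto simp: a_minus_def smult_l_distr)
  finally have t: "t = (\<Oplus>\<^bsub>P\<^esub>l\<in>L. (l \<ominus>\<^bsub>K\<^esub> m) \<odot>\<^bsub>P\<^esub> v l)" .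
  have diff: "l \<ominus>\<^bsub>K\<^esub> m \<in> carrier K" "l \<ominus>\<^bsub>K\<^esub> m \<noteq> \<zero>\<^bsub>K\<^esub>" if "l \<in> L" for l
    using that K insert.hyps by auto
  \<comment> \<open>The induction hypothesis is used for the rescaled eigenvectors, which is why
    \<open>v\<close> is arbitrary in the induction.\<close>
  have "\<forall>l\<in>L. (l \<ominus>\<^bsub>K\<^esub> m) \<odot>\<^bsub>P\<^esub> v l \<in> W"
  proof (rule insert.IH)
    show "L \<subseteq> carrier K" using K by auto
    show "\<forall>l\<in>L. (l \<ominus>\<^bsub>K\<^esub> m) \<odot>\<^bsub>P\<^esub> v l \<in> eigenspace P z l"
      using diff vc ad_v K
      by (auto simp: eigenspace_def ad_smult smult_assoc1[symmetric] m_comm)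
    show "(\<Oplus>\<^bsub>P\<^esub>l\<in>L. (l \<ominus>\<^bsub>K\<^esub> m) \<odot>\<^bsub>P\<^esub> v l) \<in> W" using tW t by simp
  qed
  have vW: "v l \<in> W" if "l \<in> L" for l
  proof -
    have "v l = (inv\<^bsub>K\<^esub> (l \<ominus>\<^bsub>K\<^esub> m)) \<odot>\<^bsub>P\<^esub> ((l \<ominus>\<^bsub>K\<^esub> m) \<odot>\<^bsub>P\<^esub> v l)"
      using diff[OF that] vc that
      by (subst smult_assoc1[symmetric]) (auto simp: field_Units)
    then show ?thesis
      using \<open>\<forall>l\<in>L. (l \<ominus>\<^bsub>K\<^esub> m) \<odot>\<^bsub>P\<^esub> v l \<in> W\<close> that diff[OF that]
      by (metis invariantD(4)[OF W] inverse_exists)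
  qed
  have "s \<in> W"
    unfolding s_def using vW by (auto intro: invariantD(6)[OF W])
  moreover have "v m = (v m \<oplus>\<^bsub>P\<^esub> s) \<ominus>\<^bsub>P\<^esub> s"
    using vc s by (simp add: a_minus_def M.a_assoc M.r_neg)
  ultimately have "v m \<in> W"
    using insert.prems(3) invariant_minus[OF W] by (metis total)
  with vW show ?case by auto
qed

text \<open>The orbit of a sum of eigenvectors equals the span of the summands: the span is
  invariant, and the orbit contains each summand by \<open>eigenvector_mem_invariant\<close>.
  Equality exhibits a finite spanning set of the orbit.\<close>

lemma Dset_subset_Fset: "Dset K P z \<subseteq> Fset K P z"
proof
  fix x assume "x \<in> Dset K P z"
  then obtain L v where L: "finite L" "L \<subseteq> Ev K P z" "\<forall>l\<in>L. v l \<in> eigenspace P z l"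
    and x: "x = finsum P v L"
    by (auto simp: Dset_def)
  have LK: "L \<subseteq> carrier K"
    using L(2) by (auto simp: Ev_def)
  have vc: "v l \<in> carrier P" and ad_v: "bracket P z (v l) = l \<odot>\<^bsub>P\<^esub> v l" if "l \<in> L" for l
    using L(3) that by (auto simp: eigenspace_def)
  have xc: "x \<in> carrier P"
    unfolding x using vc by auto
  have sub: "v ` L \<subseteq> carrier P"
    using vc by auto
  interpret S: LinearCombinations.submodule K "span (v ` L)" P
    using sub by (rule span_is_submodule)
  have vS: "v l \<in> span (v ` L)" if "l \<in> L" for l
    using in_own_span[OF sub] that by auto
  have "invariant (span (v ` L))"
  proof (rule invariantI)
    show "span (v ` L) \<subseteq> carrier P"
      by (rule S.subset)
    \<comment> \<open>The vectors that \<open>ad\<close> sends into the span form a subspace; since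
      it contains the generators, it contains the span.\<close>
    have "LinearCombinations.submodule K {y \<in> carrier P. bracket P z y \<in> span (v ` L)} P"
      using module_axioms ad_closed S.subset
      by unfold_locales (auto simp: ad_add ad_smult)
    moreover have "v ` L \<subseteq> {y \<in> carrier P. bracket P z y \<in> span (v ` L)}"
      using vc ad_v vS LK by auto
    ultimately have "span (v ` L) \<subseteq> {y \<in> carrier P. bracket P z y \<in> span (v ` L)}"
      by (intro span_is_subset)
    then show "y \<in> span (v ` L) \<Longrightarrow> bracket P z y \<in> span (v ` L)" for y
      by blast
  qed auto
  moreover from this have "x \<in> span (v ` L)"
    unfolding x using vS by (auto intro: invariantD(6))
  ultimately have "ad_orbit K P z x \<subseteq> span (v ` L)"
    by (rule ad_orbit_subset)
  moreover have "v ` L \<subseteq> ad_orbit K P z x"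
    using eigenvector_mem_invariant[OF L(1) LK L(3) invariant_ad_orbit[OF xc]] mem_ad_orbit[OF xc]
    by (auto simp: x)
  then have "span (v ` L) \<subseteq> ad_orbit K P z x"
    using invariant_ad_orbit[OF xc] by (intro span_is_subset) (auto simp: invariant_def)
  ultimately have "ad_orbit K P z x = span (v ` L)"
    by simp
  then have "finite_dimensional K P (ad_orbit K P z x)"
    using L(1) sub by (auto simp: finite_dimensional_iff)
  then show "x \<in> Fset K P z"
    using xc by (simp add: Fset_def)
qed

end

section \<open>Injective linear maps that intertwine two adjoint actions\<close>

locale ad_embedding = P: ad_linear K P z + T: ad_linear K T g + I: mod_hom K P T \<iota>
  for K :: "('k, 'l) ring_scheme" and P :: "('k, 'a, 'm) nc_poisson_scheme" and z
    and T :: "('k, 'b, 'n) nc_poisson_scheme" and g and \<iota> +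
  assumes inj: "x \<in> carrier P \<Longrightarrow> \<iota> x = \<zero>\<^bsub>T\<^esub> \<Longrightarrow> x = \<zero>\<^bsub>P\<^esub>"
    and intertwine: "x \<in> carrier P \<Longrightarrow> \<iota> (bracket P z x) = bracket T g (\<iota> x)"
    and g_closed: "g \<in> carrier T"
begin

lemma inj_eq:
  assumes "x \<in> carrier P" "y \<in> carrier P" "\<iota> x = \<iota> y"
  shows "x = y"
proof -
  have "\<iota> (x \<ominus>\<^bsub>P\<^esub> y) = \<zero>\<^bsub>T\<^esub>"
    using assms by simp
  then have "x \<ominus>\<^bsub>P\<^esub> y = \<zero>\<^bsub>P\<^esub>"
    using assms by (intro inj) auto
  then show ?thesis using assms by simp
qed

lemma invariant_image:
  assumes "P.invariant W"
  shows "T.invariant (\<iota> ` W)"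
proof (rule T.invariantI)
  note D = P.invariantD[OF assms]
  show "\<iota> ` W \<subseteq> carrier T" using D(1) by auto
  show "\<zero>\<^bsub>T\<^esub> \<in> \<iota> ` W" using D(2) I.f0_is_0 by (metis imageI)
  show "x \<oplus>\<^bsub>T\<^esub> y \<in> \<iota> ` W" if "x \<in> \<iota> ` W" "y \<in> \<iota> ` W" for x y
    using that D(1,3) by (auto simp del: I.f_add simp: I.f_add[symmetric] subset_iff)
  show "c \<odot>\<^bsub>T\<^esub> x \<in> \<iota> ` W" if "c \<in> carrier K" "x \<in> \<iota> ` W" for c x
    using that D(1,4) by (auto simp del: I.f_smult simp: I.f_smult[symmetric] subset_iff)
  show "bracket T g x \<in> \<iota> ` W" if "x \<in> \<iota> ` W" for x
    using that D(1,5) by (auto simp: intertwine[symmetric] subset_iff)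
qed

lemma invariant_vimage:
  assumes "T.invariant W"
  shows "P.invariant {x \<in> carrier P. \<iota> x \<in> W}"
  by (rule P.invariantI) (auto simp: intertwine P.ad_closed intro: T.invariantD(2-5)[OF assms])

text \<open>Both inclusions come from minimality of orbits: the image of an invariant subspace is
  invariant, and so is the preimage.\<close>

lemma ad_orbit_image:
  assumes x: "x \<in> carrier P"
  shows "ad_orbit K T g (\<iota> x) = \<iota> ` ad_orbit K P z x"
proof
  show "ad_orbit K T g (\<iota> x) \<subseteq> \<iota> ` ad_orbit K P z x"
    using x P.mem_ad_orbit by (intro T.ad_orbit_subset invariant_image P.invariant_ad_orbit) auto
  have "ad_orbit K P z x \<subseteq> {y \<in> carrier P. \<iota> y \<in> ad_orbit K T g (\<iota> x)}"
    using x T.mem_ad_orbit by (intro P.ad_orbit_subset invariant_vimage T.invariant_ad_orbit) auto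
  then show "\<iota> ` ad_orbit K P z x \<subseteq> ad_orbit K T g (\<iota> x)"
    by auto
qed

text \<open>Same argument as for orbits, with minimality of spans among submodules in place of
  minimality of orbits.\<close>

lemma span_image:
  assumes "B \<subseteq> carrier P"
  shows "T.span (\<iota> ` B) = \<iota> ` P.span B"
proof
  interpret S: LinearCombinations.submodule K "P.span B" P
    using assms by (rule P.span_is_submodule)
  have B': "\<iota> ` B \<subseteq> carrier T" using assms by auto
  interpret S': LinearCombinations.submodule K "T.span (\<iota> ` B)" T
    using B' by (rule T.span_is_submodule)
  have "LinearCombinations.submodule K (\<iota> ` P.span B) T"
  proof
    show "\<iota> ` P.span B \<subseteq> carrier T" using S.subset by auto
    show "\<zero>\<^bsub>T\<^esub> \<in> \<iota> ` P.span B" using S.zero_closed I.f0_is_0 by (metis imageI)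
    show "x \<oplus>\<^bsub>T\<^esub> y \<in> \<iota> ` P.span B" if "x \<in> \<iota> ` P.span B" "y \<in> \<iota> ` P.span B" for x y
      using that S.subset by (auto simp del: I.f_add simp: I.f_add[symmetric] subset_iff)
    show "c \<odot>\<^bsub>T\<^esub> x \<in> \<iota> ` P.span B" if "c \<in> carrier K" "x \<in> \<iota> ` P.span B" for c x
      using that S.subset by (auto simp del: I.f_smult simp: I.f_smult[symmetric] subset_iff)
  qed
  then show "T.span (\<iota> ` B) \<subseteq> \<iota> ` P.span B"
    using P.in_own_span[OF assms] by (intro T.span_is_subset) auto
  have "LinearCombinations.submodule K {y \<in> carrier P. \<iota> y \<in> T.span (\<iota> ` B)} P"
    using P.module_axioms by unfold_locales auto
  then have "P.span B \<subseteq> {y \<in> carrier P. \<iota> y \<in> T.span (\<iota> ` B)}"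
    using assms T.in_own_span[OF B'] by (intro P.span_is_subset) auto
  then show "\<iota> ` P.span B \<subseteq> T.span (\<iota> ` B)"
    by auto
qed

lemma Fset_image:
  assumes "x \<in> Fset K P z"
  shows "\<iota> x \<in> Fset K T g"
proof -
  have x: "x \<in> carrier P" and "finite_dimensional K P (ad_orbit K P z x)"
    using assms by (auto simp: Fset_def)
  then obtain B where B: "finite B" "B \<subseteq> carrier P" "ad_orbit K P z x = P.span B"
    by (auto simp: P.finite_dimensional_iff)
  have "ad_orbit K T g (\<iota> x) = T.span (\<iota> ` B)"
    using x B by (simp add: ad_orbit_image span_image)
  then have "finite_dimensional K T (ad_orbit K T g (\<iota> x))"
    using B by (auto simp: T.finite_dimensional_iff intro!: exI[of _ "\<iota> ` B"])
  then show ?thesis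
    using x by (simp add: Fset_def)
qed

lemma Ev_mono: "Ev K P z \<subseteq> Ev K T g"
proof
  fix l assume "l \<in> Ev K P z"
  then obtain x where x: "x \<in> carrier P" "x \<noteq> \<zero>\<^bsub>P\<^esub>" "bracket P z x = l \<odot>\<^bsub>P\<^esub> x"
    and l: "l \<in> carrier K"
    by (auto simp: Ev_def)
  then have "bracket T g (\<iota> x) = l \<odot>\<^bsub>T\<^esub> \<iota> x" "\<iota> x \<noteq> \<zero>\<^bsub>T\<^esub>"
    using inj by (auto simp: intertwine[symmetric])
  then show "l \<in> Ev K T g"
    using x(1) l by (auto simp: Ev_def)
qed

lemma Dset_reflect:
  assumes x: "x \<in> carrier P" and "\<iota> x \<in> Dset K T g"
  shows "x \<in> Dset K P z"
proof -
  obtain L v where L: "finite L" "L \<subseteq> Ev K T g" "\<forall>l\<in>L. v l \<in> eigenspace T g l"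
    and sum: "\<iota> x = finsum T v L"
    using assms(2) by (auto simp: Dset_def)
  have LK: "L \<subseteq> carrier K"
    using L(2) by (auto simp: Ev_def)
  have "P.invariant (carrier P)"
    by (rule P.invariantI) (auto simp: P.ad_closed)
  then have "T.invariant (\<iota> ` carrier P)"
    by (rule invariant_image)
  moreover have "finsum T v L \<in> \<iota> ` carrier P"
    using x by (simp flip: sum)
  ultimately have "\<forall>l\<in>L. v l \<in> \<iota> ` carrier P"
    by (rule T.eigenvector_mem_invariant[OF L(1) LK L(3)])
  then have "\<forall>l\<in>L. \<exists>y. y \<in> carrier P \<and> v l = \<iota> y"
    by blast
  from bchoice[OF this] obtain w where w: "\<forall>l\<in>L. w l \<in> carrier P \<and> v l = \<iota> (w l)"
    by blast
  have eig: "w l \<in> eigenspace P z l" if "l \<in> L" for l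
  proof -
    have l: "l \<in> carrier K" and wl: "w l \<in> carrier P" "v l = \<iota> (w l)"
      using subsetD[OF LK that] bspec[OF w that] by auto
    have "bracket T g (\<iota> (w l)) = l \<odot>\<^bsub>T\<^esub> \<iota> (w l)"
      using L(3) that unfolding wl(2)[symmetric] by (simp add: eigenspace_def)
    then have "\<iota> (bracket P z (w l)) = \<iota> (l \<odot>\<^bsub>P\<^esub> w l)"
      using l wl(1) by (simp add: intertwine)
    then have "bracket P z (w l) = l \<odot>\<^bsub>P\<^esub> w l"
      using l wl(1) by (intro inj_eq) (auto simp: P.ad_closed)
    then show ?thesis
      using wl(1) by (simp add: eigenspace_def)
  qed
  \<comment> \<open>A zero summand says nothing about its index: \<open>l\<close> is an eigenvalue
    for \<open>g\<close>, but possibly not for \<open>z\<close>. Since \<open>Dset\<close> admits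
    only indices from \<open>Ev K P z\<close>, such summands are discarded.\<close>
  define L' where "L' = {l \<in> L. w l \<noteq> \<zero>\<^bsub>P\<^esub>}"
  have "\<iota> x = \<iota> (finsum P w L)"
    using w unfolding sum by (subst I.hom_finsum) (auto intro: T.finsum_cong')
  then have "x = finsum P w L"
    using x w by (intro inj_eq) auto
  also have "\<dots> = finsum P w L'"
    using w L(1) by (intro P.add.finprod_mono_neutral_cong_right) (auto simp: L'_def)
  finally have "x = finsum P w L'" .
  moreover have "L' \<subseteq> Ev K P z"
    using w eig LK by (auto simp: L'_def Ev_def eigenspace_def)
  moreover have "finite L'" "\<forall>l\<in>L'. w l \<in> eigenspace P z l"
    using L(1) eig by (auto simp: L'_def)
  ultimately show ?thesis
    unfolding Dset_def by blast
qed

text \<open>The two classes differ only in whether \<open>Fset\<close> is the whole space.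
  Membership in their union therefore amounts to two strict inclusions, the one for
  \<open>Ev\<close> and the one between \<open>Dset\<close> and \<open>Fset\<close>, and both pass
  to \<open>g\<close>; which of the two classes \<open>g\<close> falls into is left open.\<close>

lemma Omega3_transfer:
  assumes "z \<in> Omega3 K P \<union> Omega3' K P"
  shows "g \<in> Omega3 K T \<union> Omega3' K T"
proof -
  have Ev: "{\<zero>\<^bsub>K\<^esub>} \<subset> Ev K P z" and D: "Dset K P z \<subset> Fset K P z"
    using assms by (auto simp: Omega3_def Omega3'_def)
  obtain x where x: "x \<in> Fset K P z" "x \<notin> Dset K P z"
    using D by blast
  then have "\<iota> x \<notin> Dset K T g"
    using Dset_reflect by (auto simp: Fset_def)
  then have "Dset K T g \<subset> Fset K T g"
    using T.Dset_subset_Fset Fset_image x by blast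
  moreover have "{\<zero>\<^bsub>K\<^esub>} \<subset> Ev K T g"
    using Ev Ev_mono by blast
  moreover have "Fset K T g \<subseteq> carrier T"
    by (auto simp: Fset_def)
  ultimately show ?thesis
    using g_closed by (auto simp: Omega3_def Omega3'_def)
qed

end

section \<open>Linear extension from a monoid algebra\<close>

lemma monoid_algebra_simps:
  "carrier (monoid_algebra K M)
    = {f. (\<forall>p. f p \<in> carrier K) \<and> finite (supp K f) \<and> supp K f \<subseteq> carrier M}"
  "zero (monoid_algebra K M) = (\<lambda>p. \<zero>\<^bsub>K\<^esub>)"
  "add (monoid_algebra K M) = (\<lambda>f g p. f p \<oplus>\<^bsub>K\<^esub> g p)"
  "smult (monoid_algebra K M) = (\<lambda>c f p. c \<otimes>\<^bsub>K\<^esub> f p)"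
  by (simp_all add: monoid_algebra_def)

lemma monoid_algebraD:
  assumes "f \<in> carrier (monoid_algebra K M)"
  shows "f p \<in> carrier K" "finite (supp K f)" "supp K f \<subseteq> carrier M"
  using assms by (auto simp: monoid_algebra_simps)

lemma (in field) monoid_algebraI:
  assumes "\<And>p. f p \<in> carrier R" "finite S" "S \<subseteq> carrier M" "\<And>p. p \<notin> S \<Longrightarrow> f p = \<zero>"
  shows "f \<in> carrier (monoid_algebra R M)"
proof -
  have "supp R f \<subseteq> S"
    using assms(4) by (auto simp: supp_def)
  then show ?thesis
    using assms finite_subset by (auto simp: monoid_algebra_simps)
qed

lemma (in field) monoid_algebra_vectorspace: "vectorspace R (monoid_algebra R M)"
proof (rule vs_criteria)
  let ?F = "monoid_algebra R M"
  note D = monoid_algebraD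
  show "\<zero>\<^bsub>?F\<^esub> \<in> carrier ?F"
    by (rule monoid_algebraI[where S = "{}"]) (auto simp: monoid_algebra_simps)
  show "\<forall>v w. v \<in> carrier ?F \<and> w \<in> carrier ?F \<longrightarrow> v \<oplus>\<^bsub>?F\<^esub> w \<in> carrier ?F"
  proof (intro allI impI)
    fix v w assume "v \<in> carrier ?F \<and> w \<in> carrier ?F"
    then show "v \<oplus>\<^bsub>?F\<^esub> w \<in> carrier ?F"
      by (intro monoid_algebraI[where S = "supp R v \<union> supp R w"])
        (auto simp: monoid_algebra_simps supp_def)
  qed
  show "\<forall>v\<in>carrier ?F. \<exists>neg_v\<in>carrier ?F. v \<oplus>\<^bsub>?F\<^esub> neg_v = \<zero>\<^bsub>?F\<^esub>"
  proof
    fix v assume v: "v \<in> carrier ?F"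
    show "\<exists>neg_v\<in>carrier ?F. v \<oplus>\<^bsub>?F\<^esub> neg_v = \<zero>\<^bsub>?F\<^esub>"
    proof
      show "(\<lambda>p. \<ominus> v p) \<in> carrier ?F"
        using v by (intro monoid_algebraI[where S = "supp R v"])
          (auto simp: monoid_algebra_simps supp_def)
      show "v \<oplus>\<^bsub>?F\<^esub> (\<lambda>p. \<ominus> v p) = \<zero>\<^bsub>?F\<^esub>"
        using v by (auto simp: monoid_algebra_simps r_neg)
    qed
  qed
  show "\<forall>c v. c \<in> carrier R \<and> v \<in> carrier ?F \<longrightarrow> c \<odot>\<^bsub>?F\<^esub> v \<in> carrier ?F"
  proof (intro allI impI)
    fix c v assume "c \<in> carrier R \<and> v \<in> carrier ?F"
    then show "c \<odot>\<^bsub>?F\<^esub> v \<in> carrier ?F"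
      by (intro monoid_algebraI[where S = "supp R v"]) (auto simp: monoid_algebra_simps supp_def)
  qed
qed (auto simp: monoid_algebra_simps a_assoc m_assoc l_distr r_distr fun_eq_iff
  intro: a_comm field_axioms)

lemma (in field) single_closed:
  "p \<in> carrier M \<Longrightarrow> single R p \<in> carrier (monoid_algebra R M)"
  by (rule monoid_algebraI[where S = "{p}"]) (auto simp: single_def)

text \<open>Bridge between sums of elements and coefficients: the product of the monoid algebra is
  given coefficient by coefficient, whereas cosets are computed from sums of basis vectors.\<close>

lemma (in field) finsum_monoid_algebra:
  assumes "g \<in> A \<rightarrow> carrier (monoid_algebra R M)"
  shows "finsum (monoid_algebra R M) g A p = (\<Oplus>a\<in>A. g a p)"
proof -
  interpret F: vectorspace R "monoid_algebra R M"
    by (rule monoid_algebra_vectorspace)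
  show ?thesis
    using assms
  proof (induction A rule: infinite_finite_induct)
    case (insert x A)
    then have "finsum (monoid_algebra R M) g (insert x A) p
      = (g x \<oplus>\<^bsub>monoid_algebra R M\<^esub> finsum (monoid_algebra R M) g A) p"
      by (subst F.M.finsum_insert) auto
    also have "\<dots> = g x p \<oplus> (\<Oplus>a\<in>A. g a p)"
      using insert by (simp add: monoid_algebra_simps(3))
    also have "\<dots> = (\<Oplus>a\<in>insert x A. g a p)"
      using insert by (subst finsum_insert) (auto simp: monoid_algebraD(1) Pi_def)
    finally show ?case .
  qed (auto simp: monoid_algebra_simps)
qed

context vectorspace
begin

definition linear_extension :: "('x \<Rightarrow> 'c) \<Rightarrow> ('x \<Rightarrow> 'a) \<Rightarrow> 'c" where
  "linear_extension h f = (\<Oplus>\<^bsub>V\<^esub>p\<in>supp K f. f p \<odot>\<^bsub>V\<^esub> h p)"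

text \<open>Terms outside the support vanish. Since the support varies with \<open>f\<close> and may
  shrink under sums and multiples, a common finite index set is needed before sums can be
  compared.\<close>

lemma linear_extension_superset:
  assumes f: "f \<in> carrier (monoid_algebra K M)" and h: "h \<in> carrier M \<rightarrow> carrier V"
    and S: "finite S" "supp K f \<subseteq> S" "S \<subseteq> carrier M"
  shows "linear_extension h f = (\<Oplus>\<^bsub>V\<^esub>p\<in>S. f p \<odot>\<^bsub>V\<^esub> h p)"
  unfolding linear_extension_def
proof (rule add.finprod_mono_neutral_cong_left)
  show "f p \<odot>\<^bsub>V\<^esub> h p = \<zero>\<^bsub>V\<^esub>" if "p \<in> S - supp K f" for p
    using that S(3) h by (auto simp: supp_def Pi_def subset_iff)
  show "(\<lambda>p. f p \<odot>\<^bsub>V\<^esub> h p) \<in> S \<rightarrow> carrier V"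
    using S(3) h monoid_algebraD(1)[OF f] by auto
qed (use S in auto)

lemma linear_extension_closed:
  assumes f: "f \<in> carrier (monoid_algebra K M)" and h: "h \<in> carrier M \<rightarrow> carrier V"
  shows "linear_extension h f \<in> carrier V"
  unfolding linear_extension_def using monoid_algebraD[OF f] h by (auto intro!: finsum_closed)

lemma linear_extension_hom:
  assumes h: "h \<in> carrier M \<rightarrow> carrier V"
  shows "mod_hom K (monoid_algebra K M) V (linear_extension h)"
proof -
  let ?F = "monoid_algebra K M"
  interpret F: vectorspace K ?F
    by (rule monoid_algebra_vectorspace)
  have add: "linear_extension h (f \<oplus>\<^bsub>?F\<^esub> g) = linear_extension h f \<oplus>\<^bsub>V\<^esub> linear_extension h g"
    if f: "f \<in> carrier ?F" and g: "g \<in> carrier ?F" for f g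
  proof -
    define S where "S = supp K f \<union> supp K g"
    have S: "finite S" "S \<subseteq> carrier M" "supp K f \<subseteq> S" "supp K g \<subseteq> S"
      using monoid_algebraD[OF f] monoid_algebraD[OF g] by (auto simp: S_def)
    have "supp K (f \<oplus>\<^bsub>?F\<^esub> g) \<subseteq> S"
      by (auto simp: S_def supp_def monoid_algebra_simps)
    then have "linear_extension h (f \<oplus>\<^bsub>?F\<^esub> g)
      = (\<Oplus>\<^bsub>V\<^esub>p\<in>S. (f \<oplus>\<^bsub>?F\<^esub> g) p \<odot>\<^bsub>V\<^esub> h p)"
      using S h f g by (intro linear_extension_superset) auto
    also have "\<dots> = (\<Oplus>\<^bsub>V\<^esub>p\<in>S. f p \<odot>\<^bsub>V\<^esub> h p \<oplus>\<^bsub>V\<^esub> g p \<odot>\<^bsub>V\<^esub> h p)"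
      using S h monoid_algebraD(1)[OF f] monoid_algebraD(1)[OF g]
      by (intro M.finsum_cong') (auto simp: monoid_algebra_simps(3) smult_l_distr Pi_def subset_iff)
    also have "\<dots> = (\<Oplus>\<^bsub>V\<^esub>p\<in>S. f p \<odot>\<^bsub>V\<^esub> h p) \<oplus>\<^bsub>V\<^esub> (\<Oplus>\<^bsub>V\<^esub>p\<in>S. g p \<odot>\<^bsub>V\<^esub> h p)"
      using S h monoid_algebraD(1)[OF f] monoid_algebraD(1)[OF g]
      by (intro M.finsum_addf) (auto simp: Pi_def subset_iff)
    also have "\<dots> = linear_extension h f \<oplus>\<^bsub>V\<^esub> linear_extension h g"
      using S h f g by (simp add: linear_extension_superset)
    finally show ?thesis .
  qed
  have smult: "linear_extension h (c \<odot>\<^bsub>?F\<^esub> f) = c \<odot>\<^bsub>V\<^esub> linear_extension h f"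
    if c: "c \<in> carrier K" and f: "f \<in> carrier ?F" for c f
  proof -
    note D = monoid_algebraD[OF f]
    have "supp K (c \<odot>\<^bsub>?F\<^esub> f) \<subseteq> supp K f"
      using c by (auto simp: supp_def monoid_algebra_simps)
    then have "linear_extension h (c \<odot>\<^bsub>?F\<^esub> f)
      = (\<Oplus>\<^bsub>V\<^esub>p\<in>supp K f. (c \<odot>\<^bsub>?F\<^esub> f) p \<odot>\<^bsub>V\<^esub> h p)"
      using D c h f by (intro linear_extension_superset) auto
    also have "\<dots> = (\<Oplus>\<^bsub>V\<^esub>p\<in>supp K f. c \<odot>\<^bsub>V\<^esub> (f p \<odot>\<^bsub>V\<^esub> h p))"
      using D c h
      by (intro M.finsum_cong') (auto simp: monoid_algebra_simps(4) smult_assoc1 Pi_def subset_iff)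
    also have "\<dots> = c \<odot>\<^bsub>V\<^esub> linear_extension h f"
      unfolding linear_extension_def
      using D c h by (intro finsum_smult[symmetric]) (auto simp: Pi_def subset_iff)
    finally show ?thesis .
  qed
  show ?thesis
    using add smult linear_extension_closed[OF _ h] by unfold_locales (auto simp: module_hom_def)
qed

lemma linear_extension_single:
  fixes M :: "('x, 'n) monoid_scheme"
  assumes "p \<in> carrier M" and h: "h \<in> carrier M \<rightarrow> carrier V"
  shows "linear_extension h (single K p) = h p"
proof -
  have "linear_extension h (single K p) = (\<Oplus>\<^bsub>V\<^esub>q\<in>{p}. single K p q \<odot>\<^bsub>V\<^esub> h q)"
    using assms single_closed[of p M]
    by (intro linear_extension_superset) (auto simp: supp_def single_def)
  also have "\<dots> = h p"
    using assms by (auto simp: single_def Pi_def)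
  finally show ?thesis .
qed

lemma linear_extension_cong:
  assumes "f \<in> carrier (monoid_algebra K M)" "h' \<in> carrier M \<rightarrow> carrier V"
    "\<And>p. p \<in> carrier M \<Longrightarrow> h p = h' p"
  shows "linear_extension h f = linear_extension h' f"
  unfolding linear_extension_def using monoid_algebraD[OF assms(1)] assms(2,3)
  by (intro M.finsum_cong') (auto simp: Pi_def subset_iff)

text \<open>Additivity in \<open>h\<close> for fixed \<open>f\<close>, in contrast to
  \<open>linear_extension_hom\<close>. When two extensions are nested, this and
  \<open>linear_extension_smult\<close> carry linearity from one argument through the extension in
  the other.\<close>

lemma linear_extension_add:
  assumes f: "f \<in> carrier (monoid_algebra K M)"
    and h: "h \<in> carrier M \<rightarrow> carrier V" "h' \<in> carrier M \<rightarrow> carrier V"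
  shows "linear_extension (\<lambda>p. h p \<oplus>\<^bsub>V\<^esub> h' p) f = linear_extension h f \<oplus>\<^bsub>V\<^esub> linear_extension h' f"
proof -
  note D = monoid_algebraD[OF f]
  have "linear_extension (\<lambda>p. h p \<oplus>\<^bsub>V\<^esub> h' p) f
    = (\<Oplus>\<^bsub>V\<^esub>p\<in>supp K f. f p \<odot>\<^bsub>V\<^esub> h p \<oplus>\<^bsub>V\<^esub> f p \<odot>\<^bsub>V\<^esub> h' p)"
    unfolding linear_extension_def
    using D h by (intro M.finsum_cong') (auto simp: Pi_def subset_iff smult_r_distr)
  also have "\<dots> = linear_extension h f \<oplus>\<^bsub>V\<^esub> linear_extension h' f"
    unfolding linear_extension_def
    using D h by (intro M.finsum_addf) (auto simp: Pi_def subset_iff)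
  finally show ?thesis .
qed

lemma linear_extension_smult:
  assumes f: "f \<in> carrier (monoid_algebra K M)"
    and h: "h \<in> carrier M \<rightarrow> carrier V" and c: "c \<in> carrier K"
  shows "linear_extension (\<lambda>p. c \<odot>\<^bsub>V\<^esub> h p) f = c \<odot>\<^bsub>V\<^esub> linear_extension h f"
proof -
  note D = monoid_algebraD[OF f]
  have "linear_extension (\<lambda>p. c \<odot>\<^bsub>V\<^esub> h p) f
    = (\<Oplus>\<^bsub>V\<^esub>p\<in>supp K f. c \<odot>\<^bsub>V\<^esub> (f p \<odot>\<^bsub>V\<^esub> h p))"
    unfolding linear_extension_def
    using D h c
    by (intro M.finsum_cong') (auto simp: Pi_def subset_iff smult_assoc1[symmetric] m_comm)
  also have "\<dots> = c \<odot>\<^bsub>V\<^esub> linear_extension h f"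
    unfolding linear_extension_def
    using D h c by (intro finsum_smult[symmetric]) (auto simp: Pi_def subset_iff)
  finally show ?thesis .
qed

end

section \<open>Quotient spaces\<close>

text \<open>\<open>T\<close> is characterised by its carrier and linear operations instead of being
  built as a quotient, so that the record \<open>tensor\<close> with its additional product and
  bracket is an instance.\<close>

locale quotient_space = V: vectorspace K V + N: LinearCombinations.submodule K N V
  for K :: "('k, 'l) ring_scheme" and V :: "('k, 'c, 'd) module_scheme" and N +
  fixes T :: "('k, 'c set, 't) module_scheme"
  assumes carrier_T: "carrier T = a_rcosets\<^bsub>V\<^esub> N"
    and zero_T: "\<zero>\<^bsub>T\<^esub> = N"
    and add_T: "add T = set_add V"
    and smult_T: "smult T = (\<lambda>c A. \<Union>f\<in>A. N +>\<^bsub>V\<^esub> (c \<odot>\<^bsub>V\<^esub> f))"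
begin

abbreviation coset :: "'c \<Rightarrow> 'c set" where
  "coset x \<equiv> N +>\<^bsub>V\<^esub> x"

sublocale A: abelian_subgroup N V
proof (rule abelian_subgroupI3)
  show "additive_subgroup N V"
  proof (rule additive_subgroup.intro, rule V.M.add.subgroupI)
    show "\<ominus>\<^bsub>V\<^esub> a \<in> N" if "a \<in> N" for a
    proof -
      have "(\<ominus>\<^bsub>K\<^esub> \<one>\<^bsub>K\<^esub>) \<odot>\<^bsub>V\<^esub> a \<in> N"
        using that by (intro N.smult_closed) auto
      then show ?thesis
        using that N.subset by (subst (asm) V.smult_minus_1) auto
    qed
    show "N \<noteq> {}" using N.zero_closed by blast
  qed (use N.subset in auto)
  show "abelian_group V" ..
qed

lemma coset_self: "x \<in> carrier V \<Longrightarrow> x \<in> coset x"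
  by (rule A.a_rcos_self)

lemma mem_cosetD:
  assumes "x \<in> carrier V" "y \<in> coset x"
  shows "y \<in> carrier V" "coset y = coset x"
  using assms A.a_elemrcos_carrier A.a_repr_independence' by blast+

lemma coset_eq_iff:
  assumes "x \<in> carrier V" "y \<in> carrier V"
  shows "coset x = coset y \<longleftrightarrow> x \<ominus>\<^bsub>V\<^esub> y \<in> N"
proof -
  have "coset x = coset y \<longleftrightarrow> x \<in> coset y"
    using assms coset_self mem_cosetD by blast
  also have "\<dots> \<longleftrightarrow> x \<oplus>\<^bsub>V\<^esub> \<ominus>\<^bsub>V\<^esub> y \<in> N"
    using assms by (intro A.a_rcos_module) auto
  finally show ?thesis by (simp add: a_minus_def)
qed

lemma coset_eq_zero_iff:
  assumes "x \<in> carrier V"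
  shows "coset x = \<zero>\<^bsub>T\<^esub> \<longleftrightarrow> x \<in> N"
proof -
  have "coset \<zero>\<^bsub>V\<^esub> = N"
    using N.subset by (intro V.M.a_coset_add_zero)
  then show ?thesis
    using coset_eq_iff[OF assms V.M.zero_closed] assms
    by (simp add: zero_T V.M.minus_zero_right)
qed

lemma coset_closed: "x \<in> carrier V \<Longrightarrow> coset x \<in> carrier T"
  unfolding carrier_T using N.subset by (rule V.M.a_rcosetsI)

lemma carrier_cosetE:
  assumes "A \<in> carrier T"
  obtains x where "x \<in> carrier V" "A = coset x"
  using assms by (auto simp: carrier_T A_RCOSETS_def')

lemma coset_add:
  "x \<in> carrier V \<Longrightarrow> y \<in> carrier V \<Longrightarrow> coset (x \<oplus>\<^bsub>V\<^esub> y) = coset x \<oplus>\<^bsub>T\<^esub> coset y"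
  by (simp add: add_T A.a_rcos_sum)

text \<open>All representatives of a coset yield the same scaled coset, as \<open>N\<close> is
  closed under scalars; the union defining the scalar multiple therefore collapses to one
  coset.\<close>

lemma coset_smult:
  assumes "c \<in> carrier K" "x \<in> carrier V"
  shows "coset (c \<odot>\<^bsub>V\<^esub> x) = c \<odot>\<^bsub>T\<^esub> coset x"
proof -
  have "coset (c \<odot>\<^bsub>V\<^esub> y) = coset (c \<odot>\<^bsub>V\<^esub> x)" if y: "y \<in> coset x" for y
  proof -
    have yV: "y \<in> carrier V" and "coset y = coset x"
      using mem_cosetD[OF assms(2) y] by auto
    then have "y \<ominus>\<^bsub>V\<^esub> x \<in> N"
      using assms coset_eq_iff by blast
    then have "c \<odot>\<^bsub>V\<^esub> (y \<ominus>\<^bsub>V\<^esub> x) \<in> N"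
      using assms by auto
    moreover have "c \<odot>\<^bsub>V\<^esub> (y \<ominus>\<^bsub>V\<^esub> x) = c \<odot>\<^bsub>V\<^esub> y \<ominus>\<^bsub>V\<^esub> c \<odot>\<^bsub>V\<^esub> x"
      using assms yV by (simp add: a_minus_def V.smult_r_distr V.smult_r_minus)
    ultimately show ?thesis
      using assms yV by (subst coset_eq_iff) auto
  qed
  then show ?thesis
    unfolding smult_T using coset_self[OF assms(2)] by blast
qed

sublocale T: vectorspace K T
proof (rule vs_criteria)
  show "field K" ..
  show "\<zero>\<^bsub>T\<^esub> \<in> carrier T"
    unfolding zero_T carrier_T by (rule A.a_subgroup_in_rcosets)
  show "\<forall>v w. v \<in> carrier T \<and> w \<in> carrier T \<longrightarrow> v \<oplus>\<^bsub>T\<^esub> w \<in> carrier T"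
    by (auto elim!: carrier_cosetE simp: coset_closed coset_add[symmetric])
  have z: "\<zero>\<^bsub>T\<^esub> = coset \<zero>\<^bsub>V\<^esub>"
    using coset_eq_zero_iff[of "\<zero>\<^bsub>V\<^esub>"] by simp
  show "\<forall>v\<in>carrier T. \<exists>neg_v\<in>carrier T. v \<oplus>\<^bsub>T\<^esub> neg_v = \<zero>\<^bsub>T\<^esub>"
  proof
    fix v assume "v \<in> carrier T"
    then obtain x where x: "x \<in> carrier V" "v = coset x"
      by (rule carrier_cosetE)
    then show "\<exists>neg_v\<in>carrier T. v \<oplus>\<^bsub>T\<^esub> neg_v = \<zero>\<^bsub>T\<^esub>"
      by (intro bexI[of _ "coset (\<ominus>\<^bsub>V\<^esub> x)"])
        (auto simp: coset_closed coset_add[symmetric] V.M.r_neg z)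
  qed
  show "\<forall>c v. c \<in> carrier K \<and> v \<in> carrier T \<longrightarrow> c \<odot>\<^bsub>T\<^esub> v \<in> carrier T"
    by (auto elim!: carrier_cosetE simp: coset_closed coset_smult[symmetric])
  show "\<forall>v w. v \<in> carrier T \<and> w \<in> carrier T \<longrightarrow> v \<oplus>\<^bsub>T\<^esub> w = w \<oplus>\<^bsub>T\<^esub> v"
    by (auto elim!: carrier_cosetE simp: coset_add[symmetric] V.M.a_comm)
  show "\<forall>v w x. v \<in> carrier T \<and> w \<in> carrier T \<and> x \<in> carrier T
      \<longrightarrow> v \<oplus>\<^bsub>T\<^esub> w \<oplus>\<^bsub>T\<^esub> x = v \<oplus>\<^bsub>T\<^esub> (w \<oplus>\<^bsub>T\<^esub> x)"
    by (auto elim!: carrier_cosetE simp: coset_add[symmetric] V.M.a_assoc)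
  show "\<forall>v\<in>carrier T. v \<oplus>\<^bsub>T\<^esub> \<zero>\<^bsub>T\<^esub> = v"
    by (auto elim!: carrier_cosetE simp: coset_add[symmetric] z)
  show "\<forall>a b v. a \<in> carrier K \<and> b \<in> carrier K \<and> v \<in> carrier T
      \<longrightarrow> a \<otimes>\<^bsub>K\<^esub> b \<odot>\<^bsub>T\<^esub> v = a \<odot>\<^bsub>T\<^esub> (b \<odot>\<^bsub>T\<^esub> v)"
    by (auto elim!: carrier_cosetE simp: coset_smult[symmetric] V.smult_assoc1)
  show "\<forall>v\<in>carrier T. \<one>\<^bsub>K\<^esub> \<odot>\<^bsub>T\<^esub> v = v"
    by (auto elim!: carrier_cosetE simp: coset_smult[symmetric])
  show "\<forall>a b v. a \<in> carrier K \<and> b \<in> carrier K \<and> v \<in> carrier T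
      \<longrightarrow> (a \<oplus>\<^bsub>K\<^esub> b) \<odot>\<^bsub>T\<^esub> v = a \<odot>\<^bsub>T\<^esub> v \<oplus>\<^bsub>T\<^esub> b \<odot>\<^bsub>T\<^esub> v"
    by (auto elim!: carrier_cosetE
        simp: coset_smult[symmetric] coset_add[symmetric] V.smult_l_distr)
  show "\<forall>a v w. a \<in> carrier K \<and> v \<in> carrier T \<and> w \<in> carrier T
      \<longrightarrow> a \<odot>\<^bsub>T\<^esub> (v \<oplus>\<^bsub>T\<^esub> w) = a \<odot>\<^bsub>T\<^esub> v \<oplus>\<^bsub>T\<^esub> a \<odot>\<^bsub>T\<^esub> w"
    by (auto elim!: carrier_cosetE
        simp: coset_smult[symmetric] coset_add[symmetric] V.smult_r_distr)
qed

sublocale coset: mod_hom K V T coset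
  by unfold_locales (auto simp: module_hom_def coset_closed coset_add coset_smult)

end

section \<open>Tensor products\<close>

context nc_poisson_algebra
begin

text \<open>The Leibniz rule for the product \<open>1 1\<close> doubles the bracket, so the bracket
  is zero.\<close>

lemma bracket_one_right:
  assumes "x \<in> carrier P"
  shows "bracket P x \<one>\<^bsub>P\<^esub> = \<zero>\<^bsub>P\<^esub>"
proof -
  have c: "bracket P x \<one>\<^bsub>P\<^esub> \<in> carrier P"
    using assms by (intro bracket_closed) auto
  have "bracket P x \<one>\<^bsub>P\<^esub> = bracket P x \<one>\<^bsub>P\<^esub> \<oplus>\<^bsub>P\<^esub> bracket P x \<one>\<^bsub>P\<^esub>"
    using leibniz[OF assms A.one_closed A.one_closed] c by simp
  then show ?thesis
    using c by (metis V.module.M.add.l_cancel_one')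
qed

text \<open>Polarisation: when the vanishing bracket of \<open>1 + x\<close> with itself is
  expanded, the other three terms are already known to be zero.\<close>

lemma bracket_one_left:
  assumes "x \<in> carrier P"
  shows "bracket P \<one>\<^bsub>P\<^esub> x = \<zero>\<^bsub>P\<^esub>"
proof -
  have c: "bracket P \<one>\<^bsub>P\<^esub> x \<in> carrier P"
    using assms by (intro bracket_closed) auto
  have "\<zero>\<^bsub>P\<^esub> = bracket P (\<one>\<^bsub>P\<^esub> \<oplus>\<^bsub>P\<^esub> x) (\<one>\<^bsub>P\<^esub> \<oplus>\<^bsub>P\<^esub> x)"
    using assms by (simp add: bracket_alternating)
  also have "\<dots> = bracket P \<one>\<^bsub>P\<^esub> x"
    using assms c by (simp add: bracket_add_left bracket_add_right
        bracket_alternating[OF assms] bracket_one_right)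
  finally show ?thesis ..
qed

end

text \<open>The argument is a pair because the basis of the free module is indexed by pairs;
  \<open>h\<close> can then be fed directly to \<open>linear_extension\<close>.\<close>

definition bilinear_into ::
  "('k, 'l) ring_scheme \<Rightarrow> ('k, 'a, 'm) module_scheme \<Rightarrow> ('k, 'b, 'n) module_scheme
    \<Rightarrow> ('k, 'c, 'd) module_scheme \<Rightarrow> ('a \<times> 'b \<Rightarrow> 'c) \<Rightarrow> bool" where
  "bilinear_into K P1 P2 V h \<longleftrightarrow>
     (\<forall>a\<in>carrier P1. \<forall>b\<in>carrier P2. h (a, b) \<in> carrier V) \<and>
     (\<forall>a\<in>carrier P1. \<forall>a'\<in>carrier P1. \<forall>b\<in>carrier P2.
        h (a \<oplus>\<^bsub>P1\<^esub> a', b) = h (a, b) \<oplus>\<^bsub>V\<^esub> h (a', b)) \<and>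
     (\<forall>a\<in>carrier P1. \<forall>b\<in>carrier P2. \<forall>b'\<in>carrier P2.
        h (a, b \<oplus>\<^bsub>P2\<^esub> b') = h (a, b) \<oplus>\<^bsub>V\<^esub> h (a, b')) \<and>
     (\<forall>c\<in>carrier K. \<forall>a\<in>carrier P1. \<forall>b\<in>carrier P2.
        h (c \<odot>\<^bsub>P1\<^esub> a, b) = c \<odot>\<^bsub>V\<^esub> h (a, b) \<and> h (a, c \<odot>\<^bsub>P2\<^esub> b) = c \<odot>\<^bsub>V\<^esub> h (a, b))"

lemma bilinear_intoD:
  assumes "bilinear_into K P1 P2 V h"
  shows "\<And>a b. a \<in> carrier P1 \<Longrightarrow> b \<in> carrier P2 \<Longrightarrow> h (a, b) \<in> carrier V"
    "\<And>a a' b. a \<in> carrier P1 \<Longrightarrow> a' \<in> carrier P1 \<Longrightarrow> b \<in> carrier P2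
      \<Longrightarrow> h (a \<oplus>\<^bsub>P1\<^esub> a', b) = h (a, b) \<oplus>\<^bsub>V\<^esub> h (a', b)"
    "\<And>a b b'. a \<in> carrier P1 \<Longrightarrow> b \<in> carrier P2 \<Longrightarrow> b' \<in> carrier P2
      \<Longrightarrow> h (a, b \<oplus>\<^bsub>P2\<^esub> b') = h (a, b) \<oplus>\<^bsub>V\<^esub> h (a, b')"
    "\<And>c a b. c \<in> carrier K \<Longrightarrow> a \<in> carrier P1 \<Longrightarrow> b \<in> carrier P2
      \<Longrightarrow> h (c \<odot>\<^bsub>P1\<^esub> a, b) = c \<odot>\<^bsub>V\<^esub> h (a, b)"
    "\<And>c a b. c \<in> carrier K \<Longrightarrow> a \<in> carrier P1 \<Longrightarrow> b \<in> carrier P2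
      \<Longrightarrow> h (a, c \<odot>\<^bsub>P2\<^esub> b) = c \<odot>\<^bsub>V\<^esub> h (a, b)"
  using assms by (auto simp: bilinear_into_def)

locale tensor_product = P1: nc_poisson_algebra K P1 + P2: nc_poisson_algebra K P2
  for K :: "('k, 'l) ring_scheme" and P1 :: "('k, 'a, 'm) nc_poisson_scheme"
    and P2 :: "('k, 'b, 'n) nc_poisson_scheme"
begin

abbreviation "F \<equiv> pair_algebra K P1 P2"
abbreviation "N \<equiv> tensor_kernel K P1 P2"
abbreviation "T \<equiv> tensor K P1 P2"
abbreviation "t \<equiv> tensor_elem K P1 P2"

lemma carrier_pair: "carrier (P1 \<times>\<times> P2) = carrier P1 \<times> carrier P2"
  by (simp add: DirProd_def)

sublocale F: vectorspace K F
  by (rule P1.monoid_algebra_vectorspace)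

lemma single_pair_closed:
  "a \<in> carrier P1 \<Longrightarrow> b \<in> carrier P2 \<Longrightarrow> single K (a, b) \<in> carrier F"
  by (rule P1.single_closed) (simp add: carrier_pair)

lemma tensor_relations_closed: "tensor_relations K P1 P2 \<subseteq> carrier F"
  by (auto simp: tensor_relations_def Let_def intro!: single_pair_closed F.M.minus_closed)

lemma tensor_kernel_submodule: "LinearCombinations.submodule K N F"
  unfolding tensor_kernel_def by (rule F.span_is_submodule[OF tensor_relations_closed])

lemma tensor_relations_subset_kernel: "tensor_relations K P1 P2 \<subseteq> N"
  unfolding tensor_kernel_def by (rule F.in_own_span[OF tensor_relations_closed])

sublocale Q: quotient_space K F N T
proof (intro quotient_space.intro quotient_space_axioms.intro)
  show "vectorspace K F" ..
  show "LinearCombinations.submodule K N F" by (rule tensor_kernel_submodule)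
qed (simp_all add: tensor_def Let_def FactRing_def)

lemma tensor_elem_eq: "t a b = Q.coset (single K (a, b))"
  by (simp add: tensor_elem_def)

lemma bilinear_into_Pi:
  "bilinear_into K P1 P2 V h \<Longrightarrow> h \<in> carrier (P1 \<times>\<times> P2) \<rightarrow> carrier V"
  by (auto simp: carrier_pair bilinear_into_def)

text \<open>Universal property of the tensor product: bilinearity says that the extension kills the
  four families of relations, and its kernel, being a submodule, contains their span.\<close>

lemma linear_extension_tensor_kernel:
  assumes "vectorspace K V" and h: "bilinear_into K P1 P2 V h" and "n \<in> N"
  shows "vectorspace.linear_extension K V h n = \<zero>\<^bsub>V\<^esub>"
proof -
  interpret V: vectorspace K V by fact
  note hP = bilinear_into_Pi[OF h]
  interpret L: mod_hom K F V "V.linear_extension h"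
    using hP by (rule V.linear_extension_hom)
  have s: "V.linear_extension h (single K (a, b)) = h (a, b)"
    if "a \<in> carrier P1" "b \<in> carrier P2" for a b
    using that hP by (intro V.linear_extension_single[where M = "P1 \<times>\<times> P2"]) (auto simp: carrier_pair)
  have "tensor_relations K P1 P2 \<subseteq> L.ker"
    using tensor_relations_closed
    by (auto simp: L.ker_def tensor_relations_def Let_def single_pair_closed s
        bilinear_intoD[OF h])
  then have "N \<subseteq> L.ker"
    unfolding tensor_kernel_def using L.ker_is_submodule by (rule F.span_is_subset)
  then show ?thesis
    using assms(3) by (auto simp: L.ker_def)
qed

text \<open>Each law of bilinearity is one of the four families of generators of \<open>N\<close>,
  read modulo \<open>N\<close>.\<close>

lemma bilinear_tensor_elem: "bilinear_into K P1 P2 T (\<lambda>(a, b). t a b)"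
proof -
  have rel: "Q.coset x = Q.coset y"
    if "x \<ominus>\<^bsub>F\<^esub> y \<in> tensor_relations K P1 P2" "x \<in> carrier F" "y \<in> carrier F" for x y
    using that tensor_relations_subset_kernel by (subst Q.coset_eq_iff) auto
  show ?thesis
    unfolding bilinear_into_def tensor_elem_eq prod.case
  proof (intro conjI ballI)
    show "Q.coset (single K (a \<oplus>\<^bsub>P1\<^esub> a', b))
      = Q.coset (single K (a, b)) \<oplus>\<^bsub>T\<^esub> Q.coset (single K (a', b))"
      if "a \<in> carrier P1" "a' \<in> carrier P1" "b \<in> carrier P2" for a a' b
      using that unfolding Q.coset_add[OF single_pair_closed single_pair_closed, symmetric, OF that(1,3,2,3)]
      by (intro rel) (auto simp: tensor_relations_def Let_def single_pair_closed)
    show "Q.coset (single K (a, b \<oplus>\<^bsub>P2\<^esub> b'))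
      = Q.coset (single K (a, b)) \<oplus>\<^bsub>T\<^esub> Q.coset (single K (a, b'))"
      if "a \<in> carrier P1" "b \<in> carrier P2" "b' \<in> carrier P2" for a b b'
      using that unfolding Q.coset_add[OF single_pair_closed single_pair_closed, symmetric, OF that(1,2,1,3)]
      by (intro rel) (auto simp: tensor_relations_def Let_def single_pair_closed)
    show "Q.coset (single K (c \<odot>\<^bsub>P1\<^esub> a, b)) = c \<odot>\<^bsub>T\<^esub> Q.coset (single K (a, b))"
      if "c \<in> carrier K" "a \<in> carrier P1" "b \<in> carrier P2" for c a b
      using that unfolding Q.coset_smult[OF _ single_pair_closed, symmetric, OF that]
      by (intro rel) (auto simp: tensor_relations_def Let_def single_pair_closed)
    show "Q.coset (single K (a, c \<odot>\<^bsub>P2\<^esub> b)) = c \<odot>\<^bsub>T\<^esub> Q.coset (single K (a, b))"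
      if "c \<in> carrier K" "a \<in> carrier P1" "b \<in> carrier P2" for c a b
      using that unfolding Q.coset_smult[OF _ single_pair_closed, symmetric, OF that]
      by (intro rel) (auto simp: tensor_relations_def Let_def single_pair_closed)
  qed (auto intro!: Q.coset_closed single_pair_closed)
qed

section \<open>Binary operations on the free module that descend to the tensor product\<close>

definition bilinear2 :: "('a \<times> 'b \<Rightarrow> 'a \<times> 'b \<Rightarrow> ('a \<times> 'b \<Rightarrow> 'k) set) \<Rightarrow> bool" where
  "bilinear2 \<beta> \<longleftrightarrow>
     (\<forall>p\<in>carrier (P1 \<times>\<times> P2). bilinear_into K P1 P2 T (\<beta> p)) \<and>
     (\<forall>r\<in>carrier (P1 \<times>\<times> P2). bilinear_into K P1 P2 T (\<lambda>p. \<beta> p r))"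

text \<open>Nesting two extensions makes the laws of \<open>linear_extension\<close> available in
  each argument separately; \<open>ext_eq_double_sum\<close> recovers the symmetric form.\<close>

definition ext ::
  "('a \<times> 'b \<Rightarrow> 'a \<times> 'b \<Rightarrow> ('a \<times> 'b \<Rightarrow> 'k) set) \<Rightarrow> ('a \<times> 'b \<Rightarrow> 'k) \<Rightarrow> ('a \<times> 'b \<Rightarrow> 'k)
    \<Rightarrow> ('a \<times> 'b \<Rightarrow> 'k) set" where
  "ext \<beta> f g = Q.T.linear_extension (\<lambda>p. Q.T.linear_extension (\<beta> p) g) f"

context
  fixes \<beta>
  assumes \<beta>: "bilinear2 \<beta>"
begin

lemma bilinear2_right: "p \<in> carrier (P1 \<times>\<times> P2) \<Longrightarrow> bilinear_into K P1 P2 T (\<beta> p)"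
  and bilinear2_left: "r \<in> carrier (P1 \<times>\<times> P2) \<Longrightarrow> bilinear_into K P1 P2 T (\<lambda>p. \<beta> p r)"
  using \<beta> by (auto simp: bilinear2_def)

lemma bilinear2_Pi: "p \<in> carrier (P1 \<times>\<times> P2) \<Longrightarrow> \<beta> p \<in> carrier (P1 \<times>\<times> P2) \<rightarrow> carrier T"
  by (rule bilinear_into_Pi[OF bilinear2_right])

lemma bilinear2_closed:
  "p \<in> carrier (P1 \<times>\<times> P2) \<Longrightarrow> r \<in> carrier (P1 \<times>\<times> P2) \<Longrightarrow> \<beta> p r \<in> carrier T"
  using bilinear2_Pi by blast

lemma inner_hom:
  "p \<in> carrier (P1 \<times>\<times> P2) \<Longrightarrow> mod_hom K F T (Q.T.linear_extension (\<beta> p))"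
  by (rule Q.T.linear_extension_hom[OF bilinear2_Pi])

text \<open>With this the outer extension in \<open>ext\<close> is again the extension of a bilinear
  map, so the universal property also applies to the first argument.\<close>

lemma inner_bilinear:
  assumes g: "g \<in> carrier F"
  shows "bilinear_into K P1 P2 T (\<lambda>p. Q.T.linear_extension (\<beta> p) g)"
  unfolding bilinear_into_def
proof (intro conjI ballI)
  fix a b assume ab: "a \<in> carrier P1" "b \<in> carrier P2"
  then have p: "(a, b) \<in> carrier (P1 \<times>\<times> P2)"
    by (simp add: carrier_pair)
  show "Q.T.linear_extension (\<beta> (a, b)) g \<in> carrier T"
    using g bilinear2_Pi[OF p] by (rule Q.T.linear_extension_closed)
  show "Q.T.linear_extension (\<beta> (c \<odot>\<^bsub>P1\<^esub> a, b)) g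
      = c \<odot>\<^bsub>T\<^esub> Q.T.linear_extension (\<beta> (a, b)) g"
    if c: "c \<in> carrier K" for c
  proof -
    have "Q.T.linear_extension (\<beta> (c \<odot>\<^bsub>P1\<^esub> a, b)) g
      = Q.T.linear_extension (\<lambda>r. c \<odot>\<^bsub>T\<^esub> \<beta> (a, b) r) g"
      using c ab bilinear2_closed[OF p] bilinear_intoD(4)[OF bilinear2_left c ab]
      by (intro Q.T.linear_extension_cong[OF g]) auto
    also have "\<dots> = c \<odot>\<^bsub>T\<^esub> Q.T.linear_extension (\<beta> (a, b)) g"
      by (rule Q.T.linear_extension_smult[OF g bilinear2_Pi[OF p] c])
    finally show ?thesis .
  qed
  show "Q.T.linear_extension (\<beta> (a, c \<odot>\<^bsub>P2\<^esub> b)) g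
      = c \<odot>\<^bsub>T\<^esub> Q.T.linear_extension (\<beta> (a, b)) g"
    if c: "c \<in> carrier K" for c
  proof -
    have "Q.T.linear_extension (\<beta> (a, c \<odot>\<^bsub>P2\<^esub> b)) g
      = Q.T.linear_extension (\<lambda>r. c \<odot>\<^bsub>T\<^esub> \<beta> (a, b) r) g"
      using c ab bilinear2_closed[OF p] bilinear_intoD(5)[OF bilinear2_left c ab]
      by (intro Q.T.linear_extension_cong[OF g]) auto
    also have "\<dots> = c \<odot>\<^bsub>T\<^esub> Q.T.linear_extension (\<beta> (a, b)) g"
      by (rule Q.T.linear_extension_smult[OF g bilinear2_Pi[OF p] c])
    finally show ?thesis .
  qed
next
  fix a a' b assume ab: "a \<in> carrier P1" "a' \<in> carrier P1" "b \<in> carrier P2"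
  then have p: "(a, b) \<in> carrier (P1 \<times>\<times> P2)" "(a', b) \<in> carrier (P1 \<times>\<times> P2)"
    by (simp_all add: carrier_pair)
  have "Q.T.linear_extension (\<beta> (a \<oplus>\<^bsub>P1\<^esub> a', b)) g
    = Q.T.linear_extension (\<lambda>r. \<beta> (a, b) r \<oplus>\<^bsub>T\<^esub> \<beta> (a', b) r) g"
    using bilinear2_closed[OF p(1)] bilinear2_closed[OF p(2)]
      bilinear_intoD(2)[OF bilinear2_left ab]
    by (intro Q.T.linear_extension_cong[OF g]) auto
  also have "\<dots> = Q.T.linear_extension (\<beta> (a, b)) g \<oplus>\<^bsub>T\<^esub> Q.T.linear_extension (\<beta> (a', b)) g"
    by (rule Q.T.linear_extension_add[OF g bilinear2_Pi bilinear2_Pi, OF p])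
  finally show "Q.T.linear_extension (\<beta> (a \<oplus>\<^bsub>P1\<^esub> a', b)) g
    = Q.T.linear_extension (\<beta> (a, b)) g \<oplus>\<^bsub>T\<^esub> Q.T.linear_extension (\<beta> (a', b)) g" .
next
  fix a b b' assume ab: "a \<in> carrier P1" "b \<in> carrier P2" "b' \<in> carrier P2"
  then have p: "(a, b) \<in> carrier (P1 \<times>\<times> P2)" "(a, b') \<in> carrier (P1 \<times>\<times> P2)"
    by (simp_all add: carrier_pair)
  have "Q.T.linear_extension (\<beta> (a, b \<oplus>\<^bsub>P2\<^esub> b')) g
    = Q.T.linear_extension (\<lambda>r. \<beta> (a, b) r \<oplus>\<^bsub>T\<^esub> \<beta> (a, b') r) g"
    using bilinear2_closed[OF p(1)] bilinear2_closed[OF p(2)]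
      bilinear_intoD(3)[OF bilinear2_left ab]
    by (intro Q.T.linear_extension_cong[OF g]) auto
  also have "\<dots> = Q.T.linear_extension (\<beta> (a, b)) g \<oplus>\<^bsub>T\<^esub> Q.T.linear_extension (\<beta> (a, b')) g"
    by (rule Q.T.linear_extension_add[OF g bilinear2_Pi bilinear2_Pi, OF p])
  finally show "Q.T.linear_extension (\<beta> (a, b \<oplus>\<^bsub>P2\<^esub> b')) g
    = Q.T.linear_extension (\<beta> (a, b)) g \<oplus>\<^bsub>T\<^esub> Q.T.linear_extension (\<beta> (a, b')) g" .
qed

lemma inner_Pi:
  "g \<in> carrier F \<Longrightarrow> (\<lambda>p. Q.T.linear_extension (\<beta> p) g) \<in> carrier (P1 \<times>\<times> P2) \<rightarrow> carrier T"
  by (rule bilinear_into_Pi[OF inner_bilinear])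

lemma ext_left_hom:
  assumes "g \<in> carrier F"
  shows "mod_hom K F T (\<lambda>f. ext \<beta> f g)"
  unfolding ext_def by (rule Q.T.linear_extension_hom[OF inner_Pi[OF assms]])

lemma ext_closed: "f \<in> carrier F \<Longrightarrow> g \<in> carrier F \<Longrightarrow> ext \<beta> f g \<in> carrier T"
  unfolding ext_def by (rule Q.T.linear_extension_closed[OF _ inner_Pi])

lemma ext_right_hom:
  assumes f: "f \<in> carrier F"
  shows "mod_hom K F T (ext \<beta> f)"
proof -
  have add: "ext \<beta> f (g \<oplus>\<^bsub>F\<^esub> g') = ext \<beta> f g \<oplus>\<^bsub>T\<^esub> ext \<beta> f g'"
    if g: "g \<in> carrier F" "g' \<in> carrier F" for g g'
  proof -
    have "ext \<beta> f (g \<oplus>\<^bsub>F\<^esub> g')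
      = Q.T.linear_extension
          (\<lambda>p. Q.T.linear_extension (\<beta> p) g \<oplus>\<^bsub>T\<^esub> Q.T.linear_extension (\<beta> p) g') f"
      unfolding ext_def
    proof (rule Q.T.linear_extension_cong[OF f])
      show "(\<lambda>p. Q.T.linear_extension (\<beta> p) g \<oplus>\<^bsub>T\<^esub> Q.T.linear_extension (\<beta> p) g')
        \<in> carrier (P1 \<times>\<times> P2) \<rightarrow> carrier T"
        using inner_Pi[OF g(1)] inner_Pi[OF g(2)] by auto
      show "Q.T.linear_extension (\<beta> p) (g \<oplus>\<^bsub>F\<^esub> g')
        = Q.T.linear_extension (\<beta> p) g \<oplus>\<^bsub>T\<^esub> Q.T.linear_extension (\<beta> p) g'"
        if "p \<in> carrier (P1 \<times>\<times> P2)" for p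
      proof -
        interpret L: mod_hom K F T "Q.T.linear_extension (\<beta> p)"
          by (rule inner_hom[OF that])
        show ?thesis by (rule L.f_add[OF g])
      qed
    qed
    also have "\<dots> = ext \<beta> f g \<oplus>\<^bsub>T\<^esub> ext \<beta> f g'"
      unfolding ext_def
      by (rule Q.T.linear_extension_add[OF f inner_Pi[OF g(1)] inner_Pi[OF g(2)]])
    finally show ?thesis .
  qed
  have smult: "ext \<beta> f (c \<odot>\<^bsub>F\<^esub> g) = c \<odot>\<^bsub>T\<^esub> ext \<beta> f g"
    if c: "c \<in> carrier K" and g: "g \<in> carrier F" for c g
  proof -
    have "ext \<beta> f (c \<odot>\<^bsub>F\<^esub> g)
      = Q.T.linear_extension (\<lambda>p. c \<odot>\<^bsub>T\<^esub> Q.T.linear_extension (\<beta> p) g) f"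
      unfolding ext_def
    proof (rule Q.T.linear_extension_cong[OF f])
      show "(\<lambda>p. c \<odot>\<^bsub>T\<^esub> Q.T.linear_extension (\<beta> p) g) \<in> carrier (P1 \<times>\<times> P2) \<rightarrow> carrier T"
        using inner_Pi[OF g] c by auto
      show "Q.T.linear_extension (\<beta> p) (c \<odot>\<^bsub>F\<^esub> g) = c \<odot>\<^bsub>T\<^esub> Q.T.linear_extension (\<beta> p) g"
        if "p \<in> carrier (P1 \<times>\<times> P2)" for p
      proof -
        interpret L: mod_hom K F T "Q.T.linear_extension (\<beta> p)"
          by (rule inner_hom[OF that])
        show ?thesis by (rule L.f_smult[OF c g])
      qed
    qed
    also have "\<dots> = c \<odot>\<^bsub>T\<^esub> ext \<beta> f g"
      unfolding ext_def by (rule Q.T.linear_extension_smult[OF f inner_Pi[OF g] c])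
    finally show ?thesis .
  qed
  show ?thesis
    using add smult ext_closed[OF f] by unfold_locales (auto simp: module_hom_def)
qed

lemma ext_single:
  assumes p: "p \<in> carrier (P1 \<times>\<times> P2)" and r: "r \<in> carrier (P1 \<times>\<times> P2)"
  shows "ext \<beta> (single K p) (single K r) = \<beta> p r"
proof -
  have "single K r \<in> carrier F"
    using r by (rule P1.single_closed)
  then have "ext \<beta> (single K p) (single K r) = Q.T.linear_extension (\<beta> p) (single K r)"
    unfolding ext_def by (intro Q.T.linear_extension_single[OF p inner_Pi])
  also have "\<dots> = \<beta> p r"
    by (rule Q.T.linear_extension_single[OF r bilinear2_Pi[OF p]])
  finally show ?thesis .
qed

text \<open>For the first argument this is the universal property applied to the outer map; for the
  second the inner extension already vanishes at every pair.\<close>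

lemma ext_kernel:
  assumes "f \<in> carrier F" "g \<in> carrier F"
  shows "f \<in> N \<Longrightarrow> ext \<beta> f g = \<zero>\<^bsub>T\<^esub>" "g \<in> N \<Longrightarrow> ext \<beta> f g = \<zero>\<^bsub>T\<^esub>"
proof -
  show "ext \<beta> f g = \<zero>\<^bsub>T\<^esub>" if "f \<in> N"
    unfolding ext_def
    by (rule linear_extension_tensor_kernel[OF Q.T.vectorspace_axioms inner_bilinear[OF assms(2)] that])
  assume "g \<in> N"
  then have "ext \<beta> f g = Q.T.linear_extension (\<lambda>p. \<zero>\<^bsub>T\<^esub>) f"
    unfolding ext_def
    by (intro Q.T.linear_extension_cong[OF assms(1)]
        linear_extension_tensor_kernel[OF Q.T.vectorspace_axioms bilinear2_right]) auto
  also have "\<dots> = \<zero>\<^bsub>T\<^esub>"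
    unfolding Q.T.linear_extension_def using monoid_algebraD(1)[OF assms(1)]
    by (intro Q.T.M.add.finprod_one_eqI) auto
  finally show "ext \<beta> f g = \<zero>\<^bsub>T\<^esub>" .
qed

text \<open>The representatives are changed one at a time, passing through
  \<open>ext \<beta> f g'\<close>; each change alters the value by an \<open>ext\<close> with one
  argument in \<open>N\<close>.\<close>

lemma ext_coset_cong:
  assumes f: "f \<in> carrier F" "f' \<in> Q.coset f" and g: "g \<in> carrier F" "g' \<in> Q.coset g"
  shows "ext \<beta> f' g' = ext \<beta> f g"
proof -
  have f': "f' \<in> carrier F" "f' \<ominus>\<^bsub>F\<^esub> f \<in> N" and g': "g' \<in> carrier F" "g' \<ominus>\<^bsub>F\<^esub> g \<in> N"
    using Q.mem_cosetD[OF f] Q.mem_cosetD[OF g] f g by (auto simp: Q.coset_eq_iff)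
  interpret L: mod_hom K F T "\<lambda>f. ext \<beta> f g'"
    by (rule ext_left_hom[OF g'(1)])
  interpret R: mod_hom K F T "ext \<beta> f"
    by (rule ext_right_hom[OF f(1)])
  have "ext \<beta> f' g' \<ominus>\<^bsub>T\<^esub> ext \<beta> f g' = \<zero>\<^bsub>T\<^esub>"
    using L.f_minus[OF f'(1) f(1)] ext_kernel(1)[OF _ g'(1) f'(2)] f f' by simp
  moreover have "ext \<beta> f g' \<ominus>\<^bsub>T\<^esub> ext \<beta> f g = \<zero>\<^bsub>T\<^esub>"
    using R.f_minus[OF g'(1) g(1)] ext_kernel(2)[OF f(1) _ g'(2)] g g' by simp
  ultimately show ?thesis
    using ext_closed f f' g g' by simp
qed

text \<open>All sets in the union coincide by \<open>ext_coset_cong\<close>, and the union is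
  nonempty because \<open>f\<close> and \<open>g\<close> represent their own cosets. Here
  \<open>op\<close> stands for the bracket or the product on the free module.\<close>

lemma union_coset_ext:
  assumes op: "\<And>f g. f \<in> carrier F \<Longrightarrow> g \<in> carrier F \<Longrightarrow> Q.coset (op f g) = ext \<beta> f g"
    and f: "f \<in> carrier F" and g: "g \<in> carrier F"
  shows "(\<Union>f'\<in>Q.coset f. \<Union>g'\<in>Q.coset g. Q.coset (op f' g')) = ext \<beta> f g"
proof -
  have "Q.coset (op f' g') = ext \<beta> f g" if "f' \<in> Q.coset f" "g' \<in> Q.coset g" for f' g'
    using that op ext_coset_cong[OF f that(1) g that(2)] Q.mem_cosetD f g by metis
  then show ?thesis
    using Q.coset_self[OF f] Q.coset_self[OF g] by blast
qed

text \<open>Distributing the outer coefficient over the inner sum gives a single sum over the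
  product of the supports, the shape in which \<open>pair_bracket\<close> and the product of the
  free module are written.\<close>

lemma ext_eq_double_sum:
  assumes f: "f \<in> carrier F" and g: "g \<in> carrier F"
  shows "ext \<beta> f g = (\<Oplus>\<^bsub>T\<^esub>r\<in>supp K f \<times> supp K g.
    (f (fst r) \<otimes>\<^bsub>K\<^esub> g (snd r)) \<odot>\<^bsub>T\<^esub> \<beta> (fst r) (snd r))"
proof -
  note Df = monoid_algebraD[OF f] and Dg = monoid_algebraD[OF g]
  have "(\<Oplus>\<^bsub>T\<^esub>r\<in>supp K f \<times> supp K g.
      (f (fst r) \<otimes>\<^bsub>K\<^esub> g (snd r)) \<odot>\<^bsub>T\<^esub> \<beta> (fst r) (snd r))
    = (\<Oplus>\<^bsub>T\<^esub>p\<in>supp K f. \<Oplus>\<^bsub>T\<^esub>r\<in>supp K g. (f p \<otimes>\<^bsub>K\<^esub> g r) \<odot>\<^bsub>T\<^esub> \<beta> p r)"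
    using Df Dg bilinear2_closed[OF subsetD[OF Df(3)] subsetD[OF Dg(3)]]
    by (subst Q.T.M.finsum_cartesian) (auto intro!: Q.T.smult_closed)
  also have "\<dots> = (\<Oplus>\<^bsub>T\<^esub>p\<in>supp K f. f p \<odot>\<^bsub>T\<^esub> (\<Oplus>\<^bsub>T\<^esub>r\<in>supp K g. g r \<odot>\<^bsub>T\<^esub> \<beta> p r))"
  proof (rule Q.T.M.finsum_cong')
    show "(\<Oplus>\<^bsub>T\<^esub>r\<in>supp K g. (f p \<otimes>\<^bsub>K\<^esub> g r) \<odot>\<^bsub>T\<^esub> \<beta> p r)
      = f p \<odot>\<^bsub>T\<^esub> (\<Oplus>\<^bsub>T\<^esub>r\<in>supp K g. g r \<odot>\<^bsub>T\<^esub> \<beta> p r)" if "p \<in> supp K f" for p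
    proof -
      have p: "p \<in> carrier (P1 \<times>\<times> P2)" using that Df by auto
      have c: "\<beta> p r \<in> carrier T" if "r \<in> supp K g" for r
        using that p Dg by (intro bilinear2_closed) auto
      have "(\<Oplus>\<^bsub>T\<^esub>r\<in>supp K g. (f p \<otimes>\<^bsub>K\<^esub> g r) \<odot>\<^bsub>T\<^esub> \<beta> p r)
        = (\<Oplus>\<^bsub>T\<^esub>r\<in>supp K g. f p \<odot>\<^bsub>T\<^esub> (g r \<odot>\<^bsub>T\<^esub> \<beta> p r))"
        using c Df(1) Dg(1) by (intro Q.T.M.finsum_cong') (auto simp: Q.T.smult_assoc1)
      also have "\<dots> = f p \<odot>\<^bsub>T\<^esub> (\<Oplus>\<^bsub>T\<^esub>r\<in>supp K g. g r \<odot>\<^bsub>T\<^esub> \<beta> p r)"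
        using c Df(1) Dg(1) by (intro Q.T.finsum_smult[symmetric]) auto
      finally show ?thesis .
    qed
    show "(\<lambda>p. f p \<odot>\<^bsub>T\<^esub> (\<Oplus>\<^bsub>T\<^esub>r\<in>supp K g. g r \<odot>\<^bsub>T\<^esub> \<beta> p r)) \<in> supp K f \<rightarrow> carrier T"
    proof
      fix p assume "p \<in> supp K f"
      then have "p \<in> carrier (P1 \<times>\<times> P2)" using Df by auto
      then have "(\<Oplus>\<^bsub>T\<^esub>r\<in>supp K g. g r \<odot>\<^bsub>T\<^esub> \<beta> p r) \<in> carrier T"
        using Dg bilinear2_closed by (intro Q.T.M.finsum_closed) auto
      then show "f p \<odot>\<^bsub>T\<^esub> (\<Oplus>\<^bsub>T\<^esub>r\<in>supp K g. g r \<odot>\<^bsub>T\<^esub> \<beta> p r) \<in> carrier T"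
        using Df(1) by (intro Q.T.smult_closed)
    qed
  qed simp
  finally show ?thesis
    by (simp add: ext_def Q.T.linear_extension_def)
qed

end

lemma tensor_elem_closed: "a \<in> carrier P1 \<Longrightarrow> b \<in> carrier P2 \<Longrightarrow> t a b \<in> carrier T"
  and tensor_elem_add_left: "a \<in> carrier P1 \<Longrightarrow> a' \<in> carrier P1 \<Longrightarrow> b \<in> carrier P2
    \<Longrightarrow> t (a \<oplus>\<^bsub>P1\<^esub> a') b = t a b \<oplus>\<^bsub>T\<^esub> t a' b"
  and tensor_elem_add_right: "a \<in> carrier P1 \<Longrightarrow> b \<in> carrier P2 \<Longrightarrow> b' \<in> carrier P2
    \<Longrightarrow> t a (b \<oplus>\<^bsub>P2\<^esub> b') = t a b \<oplus>\<^bsub>T\<^esub> t a b'"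
  and tensor_elem_smult_left: "c \<in> carrier K \<Longrightarrow> a \<in> carrier P1 \<Longrightarrow> b \<in> carrier P2
    \<Longrightarrow> t (c \<odot>\<^bsub>P1\<^esub> a) b = c \<odot>\<^bsub>T\<^esub> t a b"
  and tensor_elem_smult_right: "c \<in> carrier K \<Longrightarrow> a \<in> carrier P1 \<Longrightarrow> b \<in> carrier P2
    \<Longrightarrow> t a (c \<odot>\<^bsub>P2\<^esub> b) = c \<odot>\<^bsub>T\<^esub> t a b"
  using bilinear_intoD[OF bilinear_tensor_elem] by auto

lemmas tensor_elem_linear = tensor_elem_closed tensor_elem_add_left tensor_elem_add_right
  tensor_elem_smult_left tensor_elem_smult_right

lemma tensor_elem_zero_right:
  assumes "a \<in> carrier P1"
  shows "t a \<zero>\<^bsub>P2\<^esub> = \<zero>\<^bsub>T\<^esub>"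
  using tensor_elem_smult_right[of "\<zero>\<^bsub>K\<^esub>" a "\<zero>\<^bsub>P2\<^esub>"] assms tensor_elem_closed[of a "\<zero>\<^bsub>P2\<^esub>"]
  by simp

lemma tensor_elem_zero_left:
  assumes "b \<in> carrier P2"
  shows "t \<zero>\<^bsub>P1\<^esub> b = \<zero>\<^bsub>T\<^esub>"
  using tensor_elem_smult_left[of "\<zero>\<^bsub>K\<^esub>" "\<zero>\<^bsub>P1\<^esub>" b] assms tensor_elem_closed[of "\<zero>\<^bsub>P1\<^esub>" b]
  by simp

section \<open>Product and bracket of cosets\<close>

definition tensor_mult :: "'a \<times> 'b \<Rightarrow> 'a \<times> 'b \<Rightarrow> ('a \<times> 'b \<Rightarrow> 'k) set" where
  "tensor_mult p r = t (fst p \<otimes>\<^bsub>P1\<^esub> fst r) (snd p \<otimes>\<^bsub>P2\<^esub> snd r)"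

definition tensor_bracket :: "'a \<times> 'b \<Rightarrow> 'a \<times> 'b \<Rightarrow> ('a \<times> 'b \<Rightarrow> 'k) set" where
  "tensor_bracket p r = t (bracket P1 (fst p) (fst r)) (snd p \<otimes>\<^bsub>P2\<^esub> snd r)
    \<oplus>\<^bsub>T\<^esub> t (fst r \<otimes>\<^bsub>P1\<^esub> fst p) (bracket P2 (snd p) (snd r))"

lemma bilinear2_tensor_mult: "bilinear2 tensor_mult"
  unfolding bilinear2_def bilinear_into_def tensor_mult_def
  by (auto simp: carrier_pair tensor_elem_linear P1.l_distr P1.r_distr P2.l_distr P2.r_distr
      P1.smult_mult_left P1.smult_mult_right P2.smult_mult_left P2.smult_mult_right)

lemma bilinear2_tensor_bracket: "bilinear2 tensor_bracket"
  unfolding bilinear2_def bilinear_into_def tensor_bracket_def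
  by (auto simp: carrier_pair tensor_elem_linear P1.l_distr P1.r_distr P2.l_distr P2.r_distr
      P1.smult_mult_left P1.smult_mult_right P2.smult_mult_left P2.smult_mult_right
      P1.bracket_closed P2.bracket_closed P1.bracket_add_left P1.bracket_add_right
      P2.bracket_add_left P2.bracket_add_right P1.bracket_smult_left P1.bracket_smult_right
      P2.bracket_smult_left P2.bracket_smult_right Q.T.smult_r_distr Q.T.M.a_ac)

text \<open>Passing to cosets is linear, so it may be applied to each term of the sum defining
  \<open>pair_bracket\<close>; there it turns a sum of two basis vectors into a value of
  \<open>tensor_bracket\<close>.\<close>

lemma coset_pair_bracket:
  assumes f: "f \<in> carrier F" and g: "g \<in> carrier F"
  shows "Q.coset (pair_bracket K P1 P2 f g) = ext tensor_bracket f g"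
proof -
  note Df = monoid_algebraD[OF f] and Dg = monoid_algebraD[OF g]
  define s where "s = (\<lambda>((a1, a2), (b1, b2)).
    single K (bracket P1 a1 b1, a2 \<otimes>\<^bsub>P2\<^esub> b2) \<oplus>\<^bsub>F\<^esub> single K (b1 \<otimes>\<^bsub>P1\<^esub> a1, bracket P2 a2 b2))"
  have s: "s r \<in> carrier F \<and> Q.coset (s r) = tensor_bracket (fst r) (snd r)"
    if "r \<in> supp K f \<times> supp K g" for r
  proof -
    obtain a1 a2 b1 b2 where r: "r = ((a1, a2), (b1, b2))"
      by (metis prod.exhaust)
    have "a1 \<in> carrier P1" "a2 \<in> carrier P2" "b1 \<in> carrier P1" "b2 \<in> carrier P2"
      using that Df(3) Dg(3) by (auto simp: r carrier_pair)
    then show ?thesis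
      by (simp add: r s_def tensor_bracket_def single_pair_closed P1.bracket_closed
          P2.bracket_closed tensor_elem_eq)
  qed
  have coeff: "f (fst r) \<otimes>\<^bsub>K\<^esub> g (snd r) \<in> carrier K" for r
    using Df(1) Dg(1) by simp
  have "pair_bracket K P1 P2 f g
    = (\<Oplus>\<^bsub>F\<^esub>r\<in>supp K f \<times> supp K g. (f (fst r) \<otimes>\<^bsub>K\<^esub> g (snd r)) \<odot>\<^bsub>F\<^esub> s r)"
    unfolding pair_bracket_def Let_def s_def
    by (rule arg_cong[where f = "\<lambda>h. finsum F h _"]) auto
  then have "Q.coset (pair_bracket K P1 P2 f g)
    = (\<Oplus>\<^bsub>T\<^esub>r\<in>supp K f \<times> supp K g. Q.coset ((f (fst r) \<otimes>\<^bsub>K\<^esub> g (snd r)) \<odot>\<^bsub>F\<^esub> s r))"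
    using s coeff by (simp only:) (intro Q.coset.hom_finsum, auto)
  also have "\<dots> = (\<Oplus>\<^bsub>T\<^esub>r\<in>supp K f \<times> supp K g.
      (f (fst r) \<otimes>\<^bsub>K\<^esub> g (snd r)) \<odot>\<^bsub>T\<^esub> tensor_bracket (fst r) (snd r))"
  proof (rule Q.T.M.finsum_cong')
    show "(\<lambda>r. (f (fst r) \<otimes>\<^bsub>K\<^esub> g (snd r)) \<odot>\<^bsub>T\<^esub> tensor_bracket (fst r) (snd r))
      \<in> supp K f \<times> supp K g \<rightarrow> carrier T"
    proof
      fix r assume "r \<in> supp K f \<times> supp K g"
      then have "tensor_bracket (fst r) (snd r) \<in> carrier T"
        using s[of r] Q.coset_closed by metis
      then show "(f (fst r) \<otimes>\<^bsub>K\<^esub> g (snd r)) \<odot>\<^bsub>T\<^esub> tensor_bracket (fst r) (snd r) \<in> carrier T"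
        using coeff by (intro Q.T.smult_closed)
    qed
    show "Q.coset ((f (fst r) \<otimes>\<^bsub>K\<^esub> g (snd r)) \<odot>\<^bsub>F\<^esub> s r)
      = (f (fst r) \<otimes>\<^bsub>K\<^esub> g (snd r)) \<odot>\<^bsub>T\<^esub> tensor_bracket (fst r) (snd r)"
      if "r \<in> supp K f \<times> supp K g" for r
      using s[OF that] Q.coset_smult[OF coeff, of "s r" r] by simp
  qed simp
  also have "\<dots> = ext tensor_bracket f g"
    by (rule ext_eq_double_sum[OF bilinear2_tensor_bracket f g, symmetric])
  finally show ?thesis .
qed

text \<open>The convolution product is rewritten as a combination of basis vectors, to which the
  linear map \<open>Q.coset\<close> can be applied.\<close>

lemma pair_mult_eq:
  assumes f: "f \<in> carrier F" and g: "g \<in> carrier F"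
  shows "f \<otimes>\<^bsub>F\<^esub> g = (\<Oplus>\<^bsub>F\<^esub>r\<in>supp K f \<times> supp K g.
    (f (fst r) \<otimes>\<^bsub>K\<^esub> g (snd r)) \<odot>\<^bsub>F\<^esub> single K (fst r \<otimes>\<^bsub>P1 \<times>\<times> P2\<^esub> snd r))"
    (is "_ = finsum F ?s ?S")
proof
  fix m
  note Df = monoid_algebraD[OF f] and Dg = monoid_algebraD[OF g]
  have prod: "fst r \<otimes>\<^bsub>P1 \<times>\<times> P2\<^esub> snd r \<in> carrier (P1 \<times>\<times> P2)" if "r \<in> ?S" for r
  proof -
    obtain a1 a2 b1 b2 where r: "r = ((a1, a2), (b1, b2))"
      by (metis prod.exhaust)
    have "a1 \<in> carrier P1" "a2 \<in> carrier P2" "b1 \<in> carrier P1" "b2 \<in> carrier P2"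
      using that Df(3) Dg(3) by (auto simp: r carrier_pair)
    then show ?thesis
      by (simp add: r carrier_pair)
  qed
  have "finsum F ?s ?S m = (\<Oplus>\<^bsub>K\<^esub>r\<in>?S. ?s r m)"
    using prod Df(1) Dg(1)
    by (intro P1.finsum_monoid_algebra[where M = "P1 \<times>\<times> P2"]) (auto intro!: F.smult_closed P1.single_closed)
  \<comment> \<open>Only pairs whose product is \<open>m\<close> have a nonzero basis coefficient at
    \<open>m\<close>.\<close>
  also have "\<dots> = (\<Oplus>\<^bsub>K\<^esub>r\<in>{(p, q) \<in> ?S. p \<otimes>\<^bsub>P1 \<times>\<times> P2\<^esub> q = m}. f (fst r) \<otimes>\<^bsub>K\<^esub> g (snd r))"
    using Df Dg
    by (intro P1.R.add.finprod_mono_neutral_cong_right)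
      (auto simp: monoid_algebra_simps(4) single_def)
  finally show "(f \<otimes>\<^bsub>F\<^esub> g) m = finsum F ?s ?S m"
    by (simp add: monoid_algebra_def)
qed

lemma coset_pair_mult:
  assumes f: "f \<in> carrier F" and g: "g \<in> carrier F"
  shows "Q.coset (f \<otimes>\<^bsub>F\<^esub> g) = ext tensor_mult f g"
proof -
  note Df = monoid_algebraD[OF f] and Dg = monoid_algebraD[OF g]
  let ?s = "\<lambda>r. single K (fst r \<otimes>\<^bsub>P1 \<times>\<times> P2\<^esub> snd r)"
  have s: "?s r \<in> carrier F \<and> Q.coset (?s r) = tensor_mult (fst r) (snd r)"
    if "r \<in> supp K f \<times> supp K g" for r
  proof -
    obtain a1 a2 b1 b2 where r: "r = ((a1, a2), (b1, b2))"
      by (metis prod.exhaust)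
    have "a1 \<in> carrier P1" "a2 \<in> carrier P2" "b1 \<in> carrier P1" "b2 \<in> carrier P2"
      using that Df(3) Dg(3) by (auto simp: r carrier_pair)
    then show ?thesis
      by (simp add: r tensor_mult_def single_pair_closed tensor_elem_eq)
  qed
  have coeff: "f (fst r) \<otimes>\<^bsub>K\<^esub> g (snd r) \<in> carrier K" for r
    using Df(1) Dg(1) by simp
  have "Q.coset (f \<otimes>\<^bsub>F\<^esub> g)
    = (\<Oplus>\<^bsub>T\<^esub>r\<in>supp K f \<times> supp K g. Q.coset ((f (fst r) \<otimes>\<^bsub>K\<^esub> g (snd r)) \<odot>\<^bsub>F\<^esub> ?s r))"
    unfolding pair_mult_eq[OF f g]
    using s coeff by (intro Q.coset.hom_finsum) auto
  also have "\<dots> = (\<Oplus>\<^bsub>T\<^esub>r\<in>supp K f \<times> supp K g.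
      (f (fst r) \<otimes>\<^bsub>K\<^esub> g (snd r)) \<odot>\<^bsub>T\<^esub> tensor_mult (fst r) (snd r))"
  proof (rule Q.T.M.finsum_cong')
    show "(\<lambda>r. (f (fst r) \<otimes>\<^bsub>K\<^esub> g (snd r)) \<odot>\<^bsub>T\<^esub> tensor_mult (fst r) (snd r))
      \<in> supp K f \<times> supp K g \<rightarrow> carrier T"
    proof
      fix r assume "r \<in> supp K f \<times> supp K g"
      then have "tensor_mult (fst r) (snd r) \<in> carrier T"
        using s[of r] Q.coset_closed by metis
      then show "(f (fst r) \<otimes>\<^bsub>K\<^esub> g (snd r)) \<odot>\<^bsub>T\<^esub> tensor_mult (fst r) (snd r) \<in> carrier T"
        using coeff by (intro Q.T.smult_closed)
    qed
    show "Q.coset ((f (fst r) \<otimes>\<^bsub>K\<^esub> g (snd r)) \<odot>\<^bsub>F\<^esub> ?s r)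
      = (f (fst r) \<otimes>\<^bsub>K\<^esub> g (snd r)) \<odot>\<^bsub>T\<^esub> tensor_mult (fst r) (snd r)"
      if "r \<in> supp K f \<times> supp K g" for r
      using s[OF that] Q.coset_smult[OF coeff, of "?s r" r] by simp
  qed simp
  also have "\<dots> = ext tensor_mult f g"
    by (rule ext_eq_double_sum[OF bilinear2_tensor_mult f g, symmetric])
  finally show ?thesis .
qed

lemma bracket_tensor_class1:
  assumes "class1 P1" "class1 P2" and f: "f \<in> carrier F" and g: "g \<in> carrier F"
  shows "bracket T (Q.coset f) (Q.coset g) = ext tensor_bracket f g"
proof -
  have "bracket T (Q.coset f) (Q.coset g)
    = (\<Union>f'\<in>Q.coset f. \<Union>g'\<in>Q.coset g. Q.coset (pair_bracket K P1 P2 f' g'))"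
    using assms(1,2) by (simp add: tensor_def Let_def)
  also have "\<dots> = ext tensor_bracket f g"
    by (rule union_coset_ext[OF bilinear2_tensor_bracket coset_pair_bracket f g])
  finally show ?thesis .
qed

lemma bracket_tensor_class2:
  assumes "class2 P1" and f: "f \<in> carrier F" and g: "g \<in> carrier F"
  shows "bracket T (Q.coset f) (Q.coset g) = ext tensor_mult f g \<ominus>\<^bsub>T\<^esub> ext tensor_mult g f"
proof -
  have mult: "Q.coset f \<otimes>\<^bsub>F Quot N\<^esub> Q.coset g = ext tensor_mult f g"
    if f: "f \<in> carrier F" and g: "g \<in> carrier F" for f g
    using union_coset_ext[OF bilinear2_tensor_mult coset_pair_mult f g]
    by (simp add: FactRing_def rcoset_mult_def)
  \<comment> \<open>Subtraction is determined by carrier, addition and zero, and these fields are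
    the same in both records.\<close>
  have minus: "A \<ominus>\<^bsub>F Quot N\<^esub> B = A \<ominus>\<^bsub>T\<^esub> B" for A B
    by (simp add: a_minus_def a_inv_def m_inv_def tensor_def Let_def)
  \<comment> \<open>Class 2 includes non-commutativity, so the bracket of \<open>tensor\<close>
    takes its \<open>else\<close> branch.\<close>
  have "\<not> class1 P1"
    using assms(1) by (auto simp: class1_def class2_def)
  then have "bracket T (Q.coset f) (Q.coset g)
    = Q.coset f \<otimes>\<^bsub>F Quot N\<^esub> Q.coset g \<ominus>\<^bsub>F Quot N\<^esub> Q.coset g \<otimes>\<^bsub>F Quot N\<^esub> Q.coset f"
    by (simp add: tensor_def Let_def)
  also have "\<dots> = ext tensor_mult f g \<ominus>\<^bsub>T\<^esub> ext tensor_mult g f"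
    unfolding mult[OF f g] mult[OF g f] minus ..
  finally show ?thesis .
qed

text \<open>Every element of \<open>T\<close> is a coset, so linearity can be checked on
  representatives, where the bracket is the linear map \<open>D\<close>.\<close>

lemma ad_linear_tensorI:
  assumes "mod_hom K F T D"
    and D: "\<And>g. g \<in> carrier F \<Longrightarrow> bracket T G (Q.coset g) = D g"
  shows "ad_linear K T G"
proof -
  interpret D: mod_hom K F T D by fact
  show ?thesis
  proof
    show "bracket T G x \<in> carrier T" if "x \<in> carrier T" for x
      using that by (auto elim!: Q.carrier_cosetE simp: D)
    show "bracket T G (x \<oplus>\<^bsub>T\<^esub> y) = bracket T G x \<oplus>\<^bsub>T\<^esub> bracket T G y"
      if "x \<in> carrier T" "y \<in> carrier T" for x y
      using that by (auto elim!: Q.carrier_cosetE simp: D Q.coset_add[symmetric]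
          simp del: Q.coset.f_add)
    show "bracket T G (c \<odot>\<^bsub>T\<^esub> x) = c \<odot>\<^bsub>T\<^esub> bracket T G x"
      if "c \<in> carrier K" "x \<in> carrier T" for c x
      using that by (auto elim!: Q.carrier_cosetE simp: D Q.coset_smult[symmetric]
          simp del: Q.coset.f_smult)
  qed
qed

section \<open>The adjoint action of \<Gamma>\<close>

context
  fixes z1 z2
  assumes z1: "z1 \<in> carrier P1" and z2: "z2 \<in> carrier P2"
begin

text \<open>A representative of \<Gamma> in the free module, since \<open>ext\<close> takes
  arguments there and not cosets.\<close>

abbreviation (input) "\<gamma> \<equiv> single K (z1, \<one>\<^bsub>P2\<^esub>) \<oplus>\<^bsub>F\<^esub> single K (\<one>\<^bsub>P1\<^esub>, z2)"
abbreviation (input) "\<Gamma> \<equiv> t z1 \<one>\<^bsub>P2\<^esub> \<oplus>\<^bsub>T\<^esub> t \<one>\<^bsub>P1\<^esub> z2"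

lemma singles_closed:
  "single K (z1, \<one>\<^bsub>P2\<^esub>) \<in> carrier F" "single K (\<one>\<^bsub>P1\<^esub>, z2) \<in> carrier F"
  using z1 z2 by (auto intro: single_pair_closed)

lemma gamma_closed: "\<gamma> \<in> carrier F"
  using singles_closed by simp

lemma coset_gamma: "Q.coset \<gamma> = \<Gamma>"
  using singles_closed by (simp add: tensor_elem_eq Q.coset_add)

lemma ext_gamma_left:
  assumes "bilinear2 \<beta>" and r: "r \<in> carrier (P1 \<times>\<times> P2)"
  shows "ext \<beta> \<gamma> (single K r) = \<beta> (z1, \<one>\<^bsub>P2\<^esub>) r \<oplus>\<^bsub>T\<^esub> \<beta> (\<one>\<^bsub>P1\<^esub>, z2) r"
proof -
  interpret L: mod_hom K F T "\<lambda>f. ext \<beta> f (single K r)"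
    by (rule ext_left_hom[OF assms(1) P1.single_closed[OF r]])
  show ?thesis
    unfolding L.f_add[OF singles_closed] using r z1 z2
    by (simp add: ext_single[OF assms(1)] carrier_pair)
qed

lemma ext_gamma_right:
  assumes "bilinear2 \<beta>" and r: "r \<in> carrier (P1 \<times>\<times> P2)"
  shows "ext \<beta> (single K r) \<gamma> = \<beta> r (z1, \<one>\<^bsub>P2\<^esub>) \<oplus>\<^bsub>T\<^esub> \<beta> r (\<one>\<^bsub>P1\<^esub>, z2)"
proof -
  interpret L: mod_hom K F T "ext \<beta> (single K r)"
    by (rule ext_right_hom[OF assms(1) P1.single_closed[OF r]])
  show ?thesis
    unfolding L.f_add[OF singles_closed] using r z1 z2
    by (simp add: ext_single[OF assms(1)] carrier_pair)
qed

lemma ad_gamma: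
  assumes "class1 P1 \<and> class1 P2 \<or> class2 P1 \<and> class2 P2"
  shows "ad_linear K T \<Gamma> \<and>
    (\<forall>y\<in>carrier P1. bracket T \<Gamma> (t y \<one>\<^bsub>P2\<^esub>) = t (bracket P1 z1 y) \<one>\<^bsub>P2\<^esub>)"
  using assms
proof
  assume cl: "class1 P1 \<and> class1 P2"
  have br: "bracket T \<Gamma> (Q.coset g) = ext tensor_bracket \<gamma> g" if "g \<in> carrier F" for g
    using bracket_tensor_class1[OF _ _ gamma_closed that] cl by (simp add: coset_gamma)
  have "bracket T \<Gamma> (t y \<one>\<^bsub>P2\<^esub>) = t (bracket P1 z1 y) \<one>\<^bsub>P2\<^esub>" if y: "y \<in> carrier P1" for y
  proof -
    have r: "(y, \<one>\<^bsub>P2\<^esub>) \<in> carrier (P1 \<times>\<times> P2)"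
      using y by (simp add: carrier_pair)
    have "bracket T \<Gamma> (t y \<one>\<^bsub>P2\<^esub>) = ext tensor_bracket \<gamma> (single K (y, \<one>\<^bsub>P2\<^esub>))"
      unfolding tensor_elem_eq[of y] using y by (intro br) (simp add: single_pair_closed)
    also have "\<dots> = tensor_bracket (z1, \<one>\<^bsub>P2\<^esub>) (y, \<one>\<^bsub>P2\<^esub>)
        \<oplus>\<^bsub>T\<^esub> tensor_bracket (\<one>\<^bsub>P1\<^esub>, z2) (y, \<one>\<^bsub>P2\<^esub>)"
      by (rule ext_gamma_left[OF bilinear2_tensor_bracket r])
    \<comment> \<open>Of the four terms, three contain \<open>{1, 1}\<close>, \<open>{1, y}\<close>
      or \<open>{z\<^sub>2, 1}\<close> as a tensor factor and vanish.\<close>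
    also have "\<dots> = t (bracket P1 z1 y) \<one>\<^bsub>P2\<^esub>"
      using y z1 z2
      by (simp add: tensor_bracket_def P1.bracket_one_left P2.bracket_one_right
          tensor_elem_zero_left tensor_elem_zero_right tensor_elem_closed P1.bracket_closed)
    finally show ?thesis .
  qed
  then show ?thesis
    using ad_linear_tensorI[OF ext_right_hom[OF bilinear2_tensor_bracket gamma_closed] br] by blast
next
  assume cl: "class2 P1 \<and> class2 P2"
  interpret R: mod_hom K F T "ext tensor_mult \<gamma>"
    by (rule ext_right_hom[OF bilinear2_tensor_mult gamma_closed])
  interpret L: mod_hom K F T "\<lambda>g. ext tensor_mult g \<gamma>"
    by (rule ext_left_hom[OF bilinear2_tensor_mult gamma_closed])
  have br: "bracket T \<Gamma> (Q.coset g) = ext tensor_mult \<gamma> g \<ominus>\<^bsub>T\<^esub> ext tensor_mult g \<gamma>"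
    if "g \<in> carrier F" for g
    using bracket_tensor_class2[OF _ gamma_closed that] cl by (simp add: coset_gamma)
  have "mod_hom K F T (\<lambda>g. ext tensor_mult \<gamma> g \<ominus>\<^bsub>T\<^esub> ext tensor_mult g \<gamma>)"
  proof
    have "ext tensor_mult \<gamma> (f \<oplus>\<^bsub>F\<^esub> g) \<ominus>\<^bsub>T\<^esub> ext tensor_mult (f \<oplus>\<^bsub>F\<^esub> g) \<gamma>
      = (ext tensor_mult \<gamma> f \<ominus>\<^bsub>T\<^esub> ext tensor_mult f \<gamma>)
        \<oplus>\<^bsub>T\<^esub> (ext tensor_mult \<gamma> g \<ominus>\<^bsub>T\<^esub> ext tensor_mult g \<gamma>)"
      if "f \<in> carrier F" "g \<in> carrier F" for f g
      unfolding R.f_add[OF that] L.f_add[OF that]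
      using that R.f_im[OF that(1)] R.f_im[OF that(2)] L.f_im[OF that(1)] L.f_im[OF that(2)]
      by (simp add: a_minus_def Q.T.M.minus_add Q.T.M.a_ac)
    moreover have "ext tensor_mult \<gamma> (c \<odot>\<^bsub>F\<^esub> g) \<ominus>\<^bsub>T\<^esub> ext tensor_mult (c \<odot>\<^bsub>F\<^esub> g) \<gamma>
      = c \<odot>\<^bsub>T\<^esub> (ext tensor_mult \<gamma> g \<ominus>\<^bsub>T\<^esub> ext tensor_mult g \<gamma>)"
      if "c \<in> carrier K" "g \<in> carrier F" for c g
      unfolding R.f_smult[OF that] L.f_smult[OF that]
      using that R.f_im[OF that(2)] L.f_im[OF that(2)]
      by (simp add: a_minus_def Q.T.smult_r_distr Q.T.smult_r_minus)
    ultimately show "(\<lambda>g. ext tensor_mult \<gamma> g \<ominus>\<^bsub>T\<^esub> ext tensor_mult g \<gamma>)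
      \<in> module_hom K F T"
      using R.f_im L.f_im by (auto simp: module_hom_def)
  qed
  then have "ad_linear K T \<Gamma>"
    using br by (rule ad_linear_tensorI)
  moreover have "bracket T \<Gamma> (t y \<one>\<^bsub>P2\<^esub>) = t (bracket P1 z1 y) \<one>\<^bsub>P2\<^esub>"
    if y: "y \<in> carrier P1" for y
  proof -
    have r: "(y, \<one>\<^bsub>P2\<^esub>) \<in> carrier (P1 \<times>\<times> P2)"
      using y by (simp add: carrier_pair)
    have c: "t (z1 \<otimes>\<^bsub>P1\<^esub> y) \<one>\<^bsub>P2\<^esub> \<in> carrier T" "t (y \<otimes>\<^bsub>P1\<^esub> z1) \<one>\<^bsub>P2\<^esub> \<in> carrier T"
      "t y z2 \<in> carrier T"
      using y z1 z2 by (auto intro: tensor_elem_closed)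
    have "bracket T \<Gamma> (t y \<one>\<^bsub>P2\<^esub>) = ext tensor_mult \<gamma> (single K (y, \<one>\<^bsub>P2\<^esub>))
        \<ominus>\<^bsub>T\<^esub> ext tensor_mult (single K (y, \<one>\<^bsub>P2\<^esub>)) \<gamma>"
      unfolding tensor_elem_eq[of y] using y by (intro br) (simp add: single_pair_closed)
    \<comment> \<open>The products of \<open>1 \<otimes> z\<^sub>2\<close> and
      \<open>y \<otimes> 1\<close> in either order are both \<open>y \<otimes> z\<^sub>2\<close>,
      which then cancels.\<close>
    also have "\<dots> = (t (z1 \<otimes>\<^bsub>P1\<^esub> y) \<one>\<^bsub>P2\<^esub> \<oplus>\<^bsub>T\<^esub> t y z2)
        \<ominus>\<^bsub>T\<^esub> (t (y \<otimes>\<^bsub>P1\<^esub> z1) \<one>\<^bsub>P2\<^esub> \<oplus>\<^bsub>T\<^esub> t y z2)"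
      unfolding ext_gamma_left[OF bilinear2_tensor_mult r] ext_gamma_right[OF bilinear2_tensor_mult r]
      using y z1 z2 by (simp add: tensor_mult_def)
    also have "\<dots> = t (z1 \<otimes>\<^bsub>P1\<^esub> y) \<one>\<^bsub>P2\<^esub> \<ominus>\<^bsub>T\<^esub> t (y \<otimes>\<^bsub>P1\<^esub> z1) \<one>\<^bsub>P2\<^esub>"
      using c by (simp add: Q.T.M.a_comm[of _ "t y z2"] Q.T.M.add_minus_add_cancel)
    also have "\<dots> = t (z1 \<otimes>\<^bsub>P1\<^esub> y \<ominus>\<^bsub>P1\<^esub> y \<otimes>\<^bsub>P1\<^esub> z1) \<one>\<^bsub>P2\<^esub>"
    proof -
      interpret I: mod_hom K P1 T "\<lambda>y. t y \<one>\<^bsub>P2\<^esub>"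
        by unfold_locales (auto simp: module_hom_def tensor_elem_linear)
      show ?thesis
        using y z1 by (intro I.f_minus[symmetric]) auto
    qed
    also have "z1 \<otimes>\<^bsub>P1\<^esub> y \<ominus>\<^bsub>P1\<^esub> y \<otimes>\<^bsub>P1\<^esub> z1 = bracket P1 z1 y"
      using cl y z1 by (simp add: class2_def)
    finally show ?thesis .
  qed
  ultimately show ?thesis by blast
qed

end

section \<open>Injectivity of the embedding and the conclusion\<close>

lemma tensor_elem_one_eq_zero:
  assumes y: "y \<in> carrier P1" and "t y \<one>\<^bsub>P2\<^esub> = \<zero>\<^bsub>T\<^esub>"
  shows "y = \<zero>\<^bsub>P1\<^esub>"
proof -
  obtain \<phi> where \<phi>: "\<forall>b\<in>carrier P2. \<phi> b \<in> carrier K"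
    "\<forall>b\<in>carrier P2. \<forall>b'\<in>carrier P2. \<phi> (b \<oplus>\<^bsub>P2\<^esub> b') = \<phi> b \<oplus>\<^bsub>K\<^esub> \<phi> b'"
    "\<forall>c\<in>carrier K. \<forall>b\<in>carrier P2. \<phi> (c \<odot>\<^bsub>P2\<^esub> b) = c \<otimes>\<^bsub>K\<^esub> \<phi> b"
    "\<phi> \<one>\<^bsub>P2\<^esub> = \<one>\<^bsub>K\<^esub>"
    using P2.functional_one_exists[OF P2.A.one_closed P2.one_not_zero] by blast
  \<comment> \<open>The map induced by \<open>h\<close> on the tensor product is the retraction: at
    \<open>y \<otimes> 1\<close> its value is \<open>\<phi>(1) y = y\<close>.\<close>
  define h where "h = (\<lambda>(a, b). \<phi> b \<odot>\<^bsub>P1\<^esub> a)"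
  have h: "bilinear_into K P1 P2 P1 h"
    by (auto simp: bilinear_into_def h_def \<phi> P1.smult_l_distr P1.smult_r_distr
        P1.smult_assoc1[symmetric] P1.R.m_comm)
  \<comment> \<open>Vanishing of \<open>y \<otimes> 1\<close> is membership of its representative in
    \<open>N\<close>, where the extension of \<open>h\<close> is zero.\<close>
  have "single K (y, \<one>\<^bsub>P2\<^esub>) \<in> N"
    using assms by (simp add: tensor_elem_eq Q.coset_eq_zero_iff single_pair_closed)
  then have "P1.linear_extension h (single K (y, \<one>\<^bsub>P2\<^esub>)) = \<zero>\<^bsub>P1\<^esub>"
    by (rule linear_extension_tensor_kernel[OF P1.vectorspace_axioms h])
  also have "P1.linear_extension h (single K (y, \<one>\<^bsub>P2\<^esub>)) = h (y, \<one>\<^bsub>P2\<^esub>)"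
    using y by (intro P1.linear_extension_single[OF _ bilinear_into_Pi[OF h]]) (simp add: carrier_pair)
  finally show ?thesis
    using y by (simp add: h_def \<phi>)
qed

lemma Omega3_tensor:
  assumes cl: "class1 P1 \<and> class1 P2 \<or> class2 P1 \<and> class2 P2"
    and z1: "z1 \<in> Omega3 K P1 \<union> Omega3' K P1" and z2: "z2 \<in> carrier P2"
  shows "t z1 \<one>\<^bsub>P2\<^esub> \<oplus>\<^bsub>T\<^esub> t \<one>\<^bsub>P1\<^esub> z2 \<in> Omega3 K T \<union> Omega3' K T"
proof -
  let ?G = "t z1 \<one>\<^bsub>P2\<^esub> \<oplus>\<^bsub>T\<^esub> t \<one>\<^bsub>P1\<^esub> z2"
  have z1c: "z1 \<in> carrier P1"
    using z1 by (auto simp: Omega3_def Omega3'_def)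
  note ad = ad_gamma[OF z1c z2 cl]
  interpret ad1: ad_linear K P1 z1
    using z1c by unfold_locales
      (auto simp: P1.bracket_closed P1.bracket_add_right P1.bracket_smult_right)
  interpret adT: ad_linear K T ?G
    using ad by blast
  interpret I: mod_hom K P1 T "\<lambda>y. t y \<one>\<^bsub>P2\<^esub>"
    by unfold_locales (auto simp: module_hom_def tensor_elem_linear)
  interpret E: ad_embedding K P1 z1 T ?G "\<lambda>y. t y \<one>\<^bsub>P2\<^esub>"
  proof
    show "?G \<in> carrier T"
      using z1c z2 by (intro Q.T.M.add.m_closed tensor_elem_closed) auto
  qed (use ad tensor_elem_one_eq_zero in auto)
  show ?thesis
    using z1 by (rule E.Omega3_transfer)
qed

end

theorem corollary6p10:
  fixes K :: "('k, 'l) ring_scheme"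
    and P1 :: "('k, 'a, 'm) nc_poisson_scheme"
    and P2 :: "('k, 'b, 'n) nc_poisson_scheme"
    and u1 :: "'a \<Rightarrow> int extended"
    and u2 :: "'b \<Rightarrow> int extended"
  assumes "algebraically_closed K" and "char_zero K"
    and "nc_poisson_algebra K P1" and "nc_poisson_algebra K P2"
    and "class1 P1 \<and> class1 P2 \<or> class2 P1 \<and> class2 P2"
    and "degree_map P1 u1" and "\<forall>a\<in>carrier P1. u1 a = -\<infinity> \<or> Fin 0 \<le> u1 a"
    and "finite_filtration K P1 u1" and "discrete_filtration P1 u1"
    and "degree_map P2 u2" and "\<forall>a\<in>carrier P2. u2 a = -\<infinity> \<or> Fin 0 \<le> u2 a"
    and "finite_filtration K P2 u2" and "discrete_filtration P2 u2"
    and "z1 \<in> Omega3 K P1 \<union> Omega3' K P1" and "z2 \<in> carrier P2"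
  shows "tensor_elem K P1 P2 z1 \<one>\<^bsub>P2\<^esub> \<oplus>\<^bsub>tensor K P1 P2\<^esub> tensor_elem K P1 P2 \<one>\<^bsub>P1\<^esub> z2
    \<in> Omega3 K (tensor K P1 P2) \<union> Omega3' K (tensor K P1 P2)"
  using assms(3-5,14,15)
  by (intro tensor_product.Omega3_tensor tensor_product.intro)

end
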